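(* Let $\mathcal A$ be a finite-dimensional $C^*$-algebra over the field $\mathbb F\in\{\mathbb R,\mathbb C\}$. Then $\mathcal L_{\mathcal A}^{\bot}$ is the nonpseudo-abelian summand of $\mathcal A$, and $\mathcal L_{\mathcal A}^{\bot\bot}$ is the pseudo-abelian summand of $\mathcal A$.
   Context: For vectors $v,w$ in a normed space $V$ over $\mathbb F$, $v\perp w$ (Birkhoff–James orthogonality) means $\|v\|\le\|v+\lambda w\|$ for all $\lambda\in\mathbb F$. Put $v^\bot=\{w\in V: v\perp w\}$ and ${}^\bot v=\{w\in V: w\perp v\}$. A vector $v$ is left-symmetric if $v\perp w$ implies $w\perp v$, i.e. $v^\bot\subseteq{}^\bot v$. $\mathcal L_{\mathcal A}$ is the set of all left-symmetric elements of $\mathcal A$, and $$\mathcal L_{\mathcal A}^{\bot}:=\bigcap_{v\in\mathcal L_{\mathcal A}}v^\bot,\qquad \mathcal L_{\mathcal A}^{\bot\bot}:=\bigcap_{v\in\mathcal L_{\mathcal A}^{\bot}}v^\bot .$$ $C^*$-algebras may be real or complex. A finite-dimensional $C^*$-algebra over $\mathbb F$ is $*$-isomorphic to $\bigoplus_{k=1}^\ell\mathcal M_{n_k}(\mathbb K_k)$ with all $\mathbb K_k=\mathbb C$ if $\mathbb F=\mathbb C$ and $\mathbb K_k\in\{\mathbb R,\mathbb C,\mathbb H\}$ if $\mathbb F=\mathbb R$ (involution is conjugate transpose, norm is the maximum of the operator norms of the blocks); its minimal two-sided ideals are exactly the blocks. The pseudo-abelian summand is the sum of those minimal ideals which are skew-fields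 (equivalently the sum of all blocks of size one); the nonpseudo-abelian summand is the sum of those minimal ideals which are not skew-fields (equivalently the sum of all blocks of size bigger than one). An empty sum is $\{0\}$. *)

theory Defs
  imports "HOL-Analysis.Analysis"
begin

text \<open>
  The scalar field is a subset \<^term>\<open>F\<close> of the complex numbers, either \<^term>\<open>\<real> :: complex set\<close>
  or \<^term>\<open>UNIV :: complex set\<close>. The scalar multiplication is only constrained, and only ever used,
  for scalars in \<^term>\<open>F\<close>; on real scalars it agrees with \<^const>\<open>scaleR\<close>.
\<close>

locale normed_space_over =
  fixes F :: "complex set"
    and smul :: "complex \<Rightarrow> 'a::real_normed_vector \<Rightarrow> 'a"
  assumes scalars: "F = \<real> \<or> F = UNIV"
    and smul_add_right: "c \<in> F \<Longrightarrow> smul c (x + y) = smul c x + smul c y"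
    and smul_add_left: "c \<in> F \<Longrightarrow> d \<in> F \<Longrightarrow> smul (c + d) x = smul c x + smul d x"
    and smul_smul: "c \<in> F \<Longrightarrow> d \<in> F \<Longrightarrow> smul c (smul d x) = smul (c * d) x"
    and smul_of_real: "smul (of_real r) x = r *\<^sub>R x"
    and norm_smul: "c \<in> F \<Longrightarrow> norm (smul c x) = cmod c * norm x"

definition finite_dimensional_over :: "complex set \<Rightarrow> (complex \<Rightarrow> 'a \<Rightarrow> 'a) \<Rightarrow> 'a::real_normed_vector itself \<Rightarrow> bool"
  where "finite_dimensional_over F smul (_ :: 'a itself) \<longleftrightarrow>
    (\<exists>B :: 'a set. finite B \<and> (\<forall>x. \<exists>c. (\<forall>b\<in>B. c b \<in> F) \<and> x = (\<Sum>b\<in>B. smul (c b) b)))"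

text \<open>
  Neither a unit nor \<open>0 \<noteq> 1\<close> is assumed, so that the zero algebra is included. Completeness is not
  assumed either, since it is automatic in finite dimension. Over the reals the \<open>C\<^sup>*\<close>-identity
  alone does not characterise \<open>C\<^sup>*\<close>-algebras (consider the complex numbers with trivial
  involution), and the usual extra axiom is that \<open>1 + a\<^sup>* a\<close> is invertible in the unitization.
  It is spelled out below without a unit, the inverse being \<open>1 + b\<close>.
\<close>

locale finite_dimensional_cstar_algebra = normed_space_over F smul
  for F :: "complex set" and smul :: "complex \<Rightarrow> 'a::real_normed_algebra \<Rightarrow> 'a" +
  fixes star :: "'a \<Rightarrow> 'a"
  assumes finite_dimensional: "finite_dimensional_over F smul TYPE('a)"
    and smul_mult_left: "c \<in> F \<Longrightarrow> smul c x * y = smul c (x * y)"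
    and smul_mult_right: "c \<in> F \<Longrightarrow> x * smul c y = smul c (x * y)"
    and star_add: "star (x + y) = star x + star y"
    and star_smul: "c \<in> F \<Longrightarrow> star (smul c x) = smul (cnj c) (star x)"
    and star_mult: "star (x * y) = star y * star x"
    and star_star: "star (star x) = x"
    and cstar_identity: "norm (star x * x) = (norm x)\<^sup>2"
    and real_cstar: "F = \<real> \<Longrightarrow>
      \<exists>b. star a * a + b + star a * a * b = 0 \<and> star a * a + b + b * (star a * a) = 0"

definition bj_orthogonal ::
    "complex set \<Rightarrow> (complex \<Rightarrow> 'a \<Rightarrow> 'a) \<Rightarrow> 'a::real_normed_vector \<Rightarrow> 'a \<Rightarrow> bool"
  where "bj_orthogonal F smul v w \<longleftrightarrow> (\<forall>c\<in>F. norm v \<le> norm (v + smul c w))"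

definition right_perp ::
    "complex set \<Rightarrow> (complex \<Rightarrow> 'a \<Rightarrow> 'a) \<Rightarrow> 'a::real_normed_vector \<Rightarrow> 'a set"
  where "right_perp F smul v = {w. bj_orthogonal F smul v w}"

definition left_perp ::
    "complex set \<Rightarrow> (complex \<Rightarrow> 'a \<Rightarrow> 'a) \<Rightarrow> 'a::real_normed_vector \<Rightarrow> 'a set"
  where "left_perp F smul v = {w. bj_orthogonal F smul w v}"

definition set_perp ::
    "complex set \<Rightarrow> (complex \<Rightarrow> 'a \<Rightarrow> 'a) \<Rightarrow> 'a::real_normed_vector set \<Rightarrow> 'a set"
  where "set_perp F smul S = (\<Inter>v\<in>S. right_perp F smul v)"

definition left_symmetric_elements ::
    "complex set \<Rightarrow> (complex \<Rightarrow> 'a \<Rightarrow> 'a) \<Rightarrow> 'a::real_normed_vector set"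
  where "left_symmetric_elements F smul = {v. right_perp F smul v \<subseteq> left_perp F smul v}"

definition two_sided_ideal ::
    "complex set \<Rightarrow> (complex \<Rightarrow> 'a \<Rightarrow> 'a) \<Rightarrow> 'a::real_normed_algebra set \<Rightarrow> bool"
  where "two_sided_ideal F smul I \<longleftrightarrow>
    0 \<in> I \<and> (\<forall>x\<in>I. \<forall>y\<in>I. x + y \<in> I) \<and> (\<forall>c\<in>F. \<forall>x\<in>I. smul c x \<in> I) \<and>
    (\<forall>a. \<forall>x\<in>I. a * x \<in> I \<and> x * a \<in> I)"

definition minimal_ideal ::
    "complex set \<Rightarrow> (complex \<Rightarrow> 'a \<Rightarrow> 'a) \<Rightarrow> 'a::real_normed_algebra set \<Rightarrow> bool"
  where "minimal_ideal F smul I \<longleftrightarrow>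
    two_sided_ideal F smul I \<and> I \<noteq> {0} \<and>
    (\<forall>J. two_sided_ideal F smul J \<longrightarrow> J \<subseteq> I \<longrightarrow> J = {0} \<or> J = I)"

text \<open>The unit of a skew-field ideal is that of the ideal, not of the whole algebra.\<close>

definition skew_field_ideal :: "'a::real_normed_algebra set \<Rightarrow> bool"
  where "skew_field_ideal I \<longleftrightarrow>
    (\<exists>e\<in>I. e \<noteq> 0 \<and> (\<forall>x\<in>I. e * x = x \<and> x * e = x) \<and>
      (\<forall>x\<in>I. x \<noteq> 0 \<longrightarrow> (\<exists>y\<in>I. x * y = e \<and> y * x = e)))"

text \<open>
  \<^const>\<open>span\<close> is the real linear span. Ideals are closed under scalars from \<^term>\<open>F\<close>, so the real
  span of a union of ideals is their sum, and it is \<^term>\<open>{0}\<close> for the empty family.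
\<close>

definition pseudo_abelian_summand ::
    "complex set \<Rightarrow> (complex \<Rightarrow> 'a \<Rightarrow> 'a) \<Rightarrow> 'a::real_normed_algebra set"
  where "pseudo_abelian_summand F smul =
    span (\<Union>{I. minimal_ideal F smul I \<and> skew_field_ideal I})"

definition nonpseudo_abelian_summand ::
    "complex set \<Rightarrow> (complex \<Rightarrow> 'a \<Rightarrow> 'a) \<Rightarrow> 'a::real_normed_algebra set"
  where "nonpseudo_abelian_summand F smul =
    span (\<Union>{I. minimal_ideal F smul I \<and> \<not> skew_field_ideal I})"

end

theory Submission
  imports Defs "HOL-Computational_Algebra.Fundamental_Theorem_Algebra"
begin

text \<open>
  For blocks the picture is simple. An element \<open>v\<close> of a block of size one only sees the component of
  \<open>w\<close> in that block, where the norm comes from an inner product and orthogonality is symmetric; so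
  \<open>v\<close> is left-symmetric. Conversely every left-symmetric element lies in a block of size one. Hence
  being orthogonal to all left-symmetric elements means having no component in the blocks of size
  one, and the norm of a sum of orthogonal summands, being the maximum of their norms, gives the
  second complement as well.

  The classification of finite-dimensional \<open>C\<^sup>*\<close>-algebras is avoided: minimal projections do the work
  of the blocks. A self-adjoint element is a real combination of orthogonal minimal projections
  (\<open>spectral_decomposition\<close>), \<open>x\<^sup>*x = \<parallel>x\<parallel>\<^sup>2 p\<close> whenever \<open>xp = x\<close> for a minimal projection \<open>p\<close>
  (\<open>star_mult_self_minimal\<close>), every minimal projection lies in a minimal ideal, and these ideals
  span the algebra and are mutually orthogonal.

  For the converse, let \<open>v\<close> be left-symmetric of norm \<open>1\<close> and let it attain its norm on the minimal
  projection \<open>p\<close>. Since \<open>v\<close> is orthogonal to \<open>v - vp\<close>, left-symmetry forces \<open>v = vp\<close>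
  (\<open>left_symmetric_partial_isometry\<close>), so that \<open>v\<close> is a partial isometry from \<open>p\<close> to a minimal
  projection. If \<open>pA \<noteq> pAp\<close>, then \<open>v\<close> is a matrix unit in a copy of the real \<open>2 \<times> 2\<close> matrices, and
  an explicit matrix shows that it is not left-symmetric (\<open>matrix_unit_not_left_symmetric\<close>).
  Otherwise \<open>pA\<close> is a skew-field ideal containing \<open>v\<close>.
\<close>

section \<open>Polynomials evaluated without a unit\<close>

text \<open>
  Evaluation of a real polynomial at \<open>x\<close> with \<open>e\<close> in the role of the constant \<open>1\<close>. It is
  multiplicative when \<open>e\<close> is a unit for \<open>x\<close>; the choice \<open>e = x\<close> evaluates \<open>X f(X)\<close>, that is,
  polynomials without constant term, for which no unit is needed.
\<close>

definition horner :: "'a::real_algebra \<Rightarrow> 'a \<Rightarrow> real poly \<Rightarrow> 'a"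
  where "horner e x f = fold_coeffs (\<lambda>a y. a *\<^sub>R e + x * y) f 0"

lemma horner_0 [simp]: "horner e x 0 = 0"
  by (simp add: horner_def)

lemma horner_pCons [simp]: "horner e x (pCons a f) = a *\<^sub>R e + x * horner e x f"
  by (cases "a = 0 \<and> f = 0") (auto simp: horner_def)

lemma horner_add: "horner e x (f + g) = horner e x f + horner e x g"
  by (induction f g rule: poly_induct2) (auto simp: algebra_simps)

lemma horner_smult: "horner e x (smult c f) = c *\<^sub>R horner e x f"
  by (induction f) (auto simp: algebra_simps)

lemma horner_sum: "horner e x (sum h T) = (\<Sum>i\<in>T. horner e x (h i))"
  by (induction T rule: infinite_finite_induct) (auto simp: horner_add)

lemma horner_commutes:
  assumes "z * e = e * z" and "z * x = x * z"
  shows "z * horner e x f = horner e x f * z"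
proof (induction f)
  case (pCons a f)
  have "z * (x * horner e x f) = x * horner e x f * z"
    using assms(2) pCons(2) by (metis mult.assoc)
  then show ?case using assms(1) by (simp add: algebra_simps)
qed simp

lemma horner_absorb_left:
  assumes "e * d = d" and "e * x = x"
  shows "e * horner d x f = horner d x f"
  using assms by (cases f) (simp add: distrib_left flip: mult.assoc)

lemma horner_absorb_right:
  assumes "d * e = d" and "x * e = x"
  shows "horner d x f * e = horner d x f"
  by (induction f) (use assms in \<open>auto simp: distrib_right mult.assoc\<close>)

lemma horner_mult:
  assumes "e * e = e" and "e * x = x"
  shows "horner e x (f * g) = horner e x f * horner e x g"
proof (induction f)
  case (pCons a f)
  then show ?case
    by (simp add: horner_add horner_smult distrib_right mult.assoc horner_absorb_left assms)
qed simp

text \<open>In finite dimension the powers of an element are linearly dependent.\<close>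

lemma horner_annihilated:
  assumes "finite B" and "span B = (UNIV :: 'a::real_algebra set)"
  shows "\<exists>f. f \<noteq> 0 \<and> horner (e :: 'a) x f = 0"
proof -
  define c where "c n = horner e x (monom 1 n)" for n
  have c: "horner e x (monom a n) = a *\<^sub>R c n" for a n
    unfolding c_def horner_smult [symmetric] by (simp add: smult_monom)
  show ?thesis
  proof (cases "inj c")
    case False
    then obtain m n where mn: "m \<noteq> n" "c m = c n" by (auto simp: inj_on_def)
    let ?f = "monom 1 m + monom (-1) n :: real poly"
    have "coeff ?f m = 1" using mn by simp
    then have "?f \<noteq> 0" by (metis coeff_0 zero_neq_one)
    moreover have "horner e x ?f = 0" using mn by (simp add: horner_add c)
    ultimately show ?thesis by blast
  next
    case True
    then have "infinite (range c)" by (rule range_inj_infinite)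
    then have "dependent (range c)"
      using independent_span_bound[OF assms(1), of "range c"] assms(2) by auto
    then obtain T u v where T: "finite T" "T \<subseteq> range c" "v \<in> T" "u v \<noteq> 0"
        and sum0: "(\<Sum>v\<in>T. u v *\<^sub>R v) = 0"
      unfolding dependent_explicit by blast
    let ?f = "\<Sum>w\<in>T. monom (u w) (inv c w)"
    have "c (inv c w) = w" if "w \<in> T" for w
      using that T(2) by (meson f_inv_into_f subset_eq)
    then have "horner e x ?f = 0" using sum0 by (simp add: horner_sum c)
    moreover have "coeff ?f (inv c v) = u v"
    proof -
      have "coeff ?f (inv c v) = (\<Sum>w\<in>T. if w = v then u v else 0)"
        unfolding coeff_sum
      proof (rule sum.cong)
        fix w assume "w \<in> T"
        then have "inv c w = inv c v \<longleftrightarrow> w = v"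
          using T by (metis f_inv_into_f subset_eq)
        then show "coeff (monom (u w) (inv c w)) (inv c v) = (if w = v then u v else 0)"
          by auto
      qed simp
      then show ?thesis using T by simp
    qed
    then have "?f \<noteq> 0" using T(4) by (metis coeff_0)
    ultimately show ?thesis by blast
  qed
qed

text \<open>
  A real polynomial of positive degree has a complex root, and dividing by the minimal polynomial
  of that root over the reals leaves no remainder.
\<close>

lemma real_poly_factor:
  fixes f :: "real poly"
  assumes "degree f > 0"
  shows "\<exists>a b. [:-a, 1:] dvd f \<or> b \<noteq> 0 \<and> [:a\<^sup>2 + b\<^sup>2, -2 * a, 1:] dvd f"
proof -
  have eval: "poly (map_poly complex_of_real g) z = horner 1 z g" for g and z :: complex
    by (induction g) (auto simp: map_poly_pCons scaleR_conv_of_real)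
  have "degree (map_poly complex_of_real f) = degree f" by (simp add: degree_map_poly)
  then have "\<not> constant (poly (map_poly complex_of_real f))"
    using assms constant_degree[of "map_poly complex_of_real f"] by simp
  then obtain z :: complex where z: "horner 1 z f = 0"
    using fundamental_theorem_of_algebra eval by metis
  show ?thesis
  proof (cases "Im z = 0")
    case True
    then have "z = complex_of_real (Re z)" by (simp add: complex_eq_iff)
    moreover have "horner 1 (complex_of_real r) g = of_real (poly g r)" for r g
      by (induction g) (auto simp: scaleR_conv_of_real)
    ultimately have "poly f (Re z) = 0" using z by (metis of_real_eq_0_iff)
    then show ?thesis using poly_eq_0_iff_dvd by metis
  next
    case False
    let ?m = "[:(Re z)\<^sup>2 + (Im z)\<^sup>2, -2 * Re z, 1:]"
    have "degree (f mod ?m) < 2"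
      using degree_mod_less[of ?m f] by (cases "f mod ?m = 0") auto
    obtain b g where bg: "f mod ?m = pCons b g" by (cases "f mod ?m")
    obtain c h where ch: "g = pCons c h" by (cases g)
    have h0: "h = 0"
      using \<open>degree (f mod ?m) < 2\<close> unfolding bg ch by (auto split: if_splits)
    have bc: "f mod ?m = [:b, c:]" unfolding bg ch h0 by (rule refl)
    have "horner 1 z ?m = 0"
      by (simp add: complex_eq_iff power2_eq_square algebra_simps)
    moreover have "f = ?m * (f div ?m) + [:b, c:]" using bc by (metis mult_div_mod_eq)
    then have "horner 1 z f = horner 1 z ?m * horner 1 z (f div ?m) + horner 1 z [:b, c:]"
      by (metis horner_add horner_mult mult_1)
    ultimately have "horner 1 z [:b, c:] = 0" using z by simp
    then have "c = 0" "b = 0" using False by (auto simp: complex_eq_iff)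
    then have "?m dvd f" using bc by (simp add: mod_eq_0_iff_dvd)
    then show ?thesis using False by blast
  qed
qed

context finite_dimensional_cstar_algebra
begin

section \<open>The norm and orthogonal sums\<close>

lemma of_real_in_scalars [simp]: "complex_of_real r \<in> F"
  using scalars by auto

lemma one_in_scalars [simp]: "1 \<in> F"
  using of_real_in_scalars[of 1] by simp

lemma cnj_in_scalars: "c \<in> F \<Longrightarrow> cnj c \<in> F"
  using scalars by (auto simp: Reals_cnj_iff)

lemma smul_1 [simp]: "smul 1 x = x"
  using smul_of_real[of 1] by simp

lemma star_scaleR: "star (r *\<^sub>R x) = r *\<^sub>R star x"
  using star_smul[of "complex_of_real r" x] by (simp add: smul_of_real)

lemma star_0 [simp]: "star 0 = 0"
  using star_scaleR[of 0] by simp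

lemma star_minus: "star (- x) = - star x"
  using star_scaleR[of "-1" x] by simp

lemma star_diff: "star (x - y) = star x - star y"
  using star_add[of x "- y"] by (simp add: star_minus)

lemma star_sum: "star (sum g T) = (\<Sum>i\<in>T. star (g i))"
  by (induction T rule: infinite_finite_induct) (auto simp: star_add)

lemma star_eq_0 [simp]: "star x = 0 \<longleftrightarrow> x = 0"
  using star_star star_0 by metis

lemma star_mult_self_eq_0: "star x * x = 0 \<longleftrightarrow> x = 0"
  using cstar_identity[of x] by auto

lemma norm_star: "norm (star x) = norm x"
proof -
  have "norm x \<le> norm (star x)" for x
  proof (cases "x = 0")
    case False
    have "norm x * norm x \<le> norm (star x) * norm x"
      using norm_mult_ineq[of "star x" x] by (simp add: cstar_identity power2_eq_square)
    then show ?thesis using False by simp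
  qed simp
  from this[of x] this[of "star x"] show ?thesis by (simp add: star_star)
qed

text \<open>
  Squaring the sum of two orthogonal self-adjoint elements squares the summands, so the triangle
  inequality for the \<open>2\<^sup>n\<close>-th powers loses only the factor \<open>2\<close>, which disappears in the limit.
\<close>

lemma norm_add_self_adjoint_le:
  assumes "star a = a" "star b = b" "a * b = 0" "norm a \<le> M" "norm b \<le> M"
  shows "norm (a + b) \<le> M"
proof -
  have pow: "norm (a + b) ^ 2 ^ n \<le> 2 * M ^ 2 ^ n"
    if "star a = a" "star b = b" "a * b = 0" "norm a \<le> M" "norm b \<le> M" for a b M n
    using that
  proof (induction n arbitrary: a b M)
    case 0
    then show ?case using norm_triangle_ineq[of a b] by simp
  next
    case (Suc n)
    have ba: "b * a = 0" using Suc.prems by (metis star_0 star_mult)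
    have sq: "norm (x * x) = (norm x)\<^sup>2" if "star x = x" for x
      using cstar_identity[of x] that by simp
    have M: "0 \<le> M" using Suc.prems norm_ge_zero order_trans by blast
    have ab: "star (a + b) = a + b" using Suc.prems by (simp add: star_add)
    have "norm (a + b) ^ 2 ^ Suc n = norm ((a + b) * (a + b)) ^ 2 ^ n"
      by (simp add: sq ab power_mult)
    also have "(a + b) * (a + b) = a * a + b * b"
      using Suc.prems ba by (simp add: algebra_simps)
    also have "norm (a * a + b * b) ^ 2 ^ n \<le> 2 * (M\<^sup>2) ^ 2 ^ n"
    proof (rule Suc.IH)
      show "a * a * (b * b) = 0" using Suc.prems by (metis mult.assoc mult_zero_left mult_zero_right)
    qed (use Suc.prems M sq in \<open>auto simp: star_mult power_mono\<close>)
    finally show ?case by (simp add: power_mult)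
  qed
  have M: "0 \<le> M" using assms(4) norm_ge_zero order_trans by blast
  show ?thesis
  proof (rule ccontr)
    assume "\<not> norm (a + b) \<le> M"
    then have less: "M < norm (a + b)" by simp
    show False
    proof (cases "M = 0")
      case True
      then show False using pow[OF assms, of 0] less by simp
    next
      case False
      define t where "t = norm (a + b) / M"
      have t: "1 < t" using less M False by (simp add: t_def)
      obtain n where "2 < t ^ n" using real_arch_pow[OF t] by blast
      also have "\<dots> \<le> t ^ 2 ^ n" using t by (intro power_increasing) auto
      also have "\<dots> = norm (a + b) ^ 2 ^ n / M ^ 2 ^ n" by (simp add: t_def power_divide)
      also have "\<dots> \<le> 2"
        using pow[OF assms, of n] M False by (simp add: divide_le_eq)
      finally show False by simp
    qed
  qed
qed

text \<open>The norm of a sum of two elements with orthogonal supports on both sides.\<close>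

lemma norm_add_orthogonal:
  assumes "star x * y = 0" "x * star y = 0"
  shows "norm (x + y) = max (norm x) (norm y)"
proof (rule antisym)
  have yx: "star y * x = 0" "y * star x = 0"
    using assms star_mult star_star star_0 by metis+
  let ?M = "max (norm x) (norm y)"
  have "(norm (x + y))\<^sup>2 = norm (star x * x + star y * y)"
    using assms yx by (simp flip: cstar_identity add: star_add algebra_simps)
  also have "\<dots> \<le> ?M\<^sup>2"
  proof (rule norm_add_self_adjoint_le)
    show "star x * x * (star y * y) = 0"
      using assms by (metis mult.assoc mult_zero_left mult_zero_right)
  qed (auto simp: star_mult star_star cstar_identity power_mono)
  finally show "norm (x + y) \<le> ?M" by (rule power2_le_imp_le) (simp add: le_max_iff_disj)
  have ge: "norm x \<le> norm (x + y)" if "star x * y = 0" for x y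
  proof (cases "x = 0")
    case False
    have "(norm x)\<^sup>2 = norm (star x * (x + y))"
      using that by (simp add: distrib_left flip: cstar_identity)
    also have "\<dots> \<le> norm x * norm (x + y)" by (metis norm_mult_ineq norm_star)
    finally show ?thesis using False by (simp add: power2_eq_square)
  qed simp
  show "?M \<le> norm (x + y)" using ge[OF assms(1)] ge[OF yx(1)] by (simp add: add.commute)
qed

section \<open>Projections and spectral decomposition\<close>

definition projection :: "'a \<Rightarrow> bool"
  where "projection e \<longleftrightarrow> e * e = e \<and> star e = e"

text \<open>
  Minimality is expressed through the compression \<open>pAp\<close>: its self-adjoint elements have to be the
  real multiples of \<open>p\<close>, while \<open>pAp\<close> itself may also be a copy of the complex numbers or the
  quaternions.
\<close>

definition minimal_projection :: "'a \<Rightarrow> bool"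
  where "minimal_projection p \<longleftrightarrow> projection p \<and> p \<noteq> 0 \<and>
    (\<forall>x. star x = x \<longrightarrow> p * x = x \<longrightarrow> x * p = x \<longrightarrow> (\<exists>r. x = r *\<^sub>R p))"

lemma norm_projection:
  assumes "projection e" "e \<noteq> 0"
  shows "norm e = 1"
  using cstar_identity[of e] assms by (simp add: projection_def power2_eq_square)

lemma projection_absorb:
  assumes "projection e" "projection f" "e * f = e"
  shows "f * e = e"
  using assms star_mult unfolding projection_def by metis

lemma projection_orthogonal:
  assumes "projection e" "projection f" "e * f = 0"
  shows "f * e = 0"
  using assms star_mult star_0 unfolding projection_def by metis

text \<open>
  Over the real scalars \<open>h\<^sup>2 = -e\<close> would make \<open>1 + h\<^sup>*h\<close> vanish on \<open>e\<close>; this rules out the complex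
  numbers with trivial involution. Over the complex scalars the product of \<open>h + \<i>e\<close> with its adjoint
  is zero, so \<open>h = -\<i>e\<close>, which is self-adjoint only if \<open>e = 0\<close>.
\<close>

lemma no_imaginary_unit:
  assumes "projection e" "star h = h" "h * h = - e" "h * e = h"
  shows "e = 0"
proof -
  have e: "e * e = e" "star e = e" using assms(1) by (auto simp: projection_def)
  have eh: "e * h = h" using assms(2,4) e(2) star_mult by metis
  consider "F = \<real>" | "F = UNIV" using scalars by blast
  then show ?thesis
  proof cases
    case 1
    obtain b where "- e + b + - e * b = 0" using real_cstar[OF 1, of h] assms(2,3) by auto
    then have "e * (- e + b + - e * b) = 0" by simp
    then show ?thesis using e by (simp add: distrib_left right_diff_distrib flip: mult.assoc)
  next
    case 2
    let ?k = "smul \<i> e"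
    have k: "star ?k = - ?k" 
      using 2 star_smul[of \<i> e] e smul_smul[of "-1" \<i> e] smul_of_real[of "-1" "?k"] by simp
    have "?k * h = smul \<i> h" "h * ?k = smul \<i> h" "?k * ?k = smul (-1) e"
      using 2 eh assms(4) e by (simp_all add: smul_mult_left smul_mult_right smul_smul)
    moreover have "smul (-1) e = - e" using smul_of_real[of "-1" e] by simp
    ultimately have "star (h + ?k) * (h + ?k) = 0"
      using assms(2,3) k by (simp add: star_add algebra_simps)
    then have hk: "h = - ?k" by (simp add: star_mult_self_eq_0 add_eq_0_iff)
    then have "star h = ?k" by (simp add: star_minus k)
    then have "h + h = ?k + (- ?k)" using hk assms(2) by metis
    then have "2 *\<^sub>R h = 0" by (simp add: scaleR_2)
    then show ?thesis using assms(3) by simp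
  qed
qed

lemma finite_real_span: "\<exists>B. finite B \<and> span B = (UNIV :: 'a set)"
proof -
  obtain B :: "'a set" where B: "finite B"
    and rep: "\<And>x. \<exists>c. (\<forall>b\<in>B. c b \<in> F) \<and> x = (\<Sum>b\<in>B. smul (c b) b)"
    using finite_dimensional unfolding finite_dimensional_over_def by blast
  let ?B = "B \<union> smul \<i> ` B"
  have term_in: "smul c b \<in> span ?B" if c: "c \<in> F" and "b \<in> B" for c b
  proof -
    consider "F = \<real>" | "F = UNIV" using scalars by blast
    then show ?thesis
    proof cases
      case 1
      then obtain r where "c = of_real r" using c by (auto elim: Reals_cases)
      then show ?thesis using that by (simp add: smul_of_real span_base span_scale)
    next
      case 2
      have "smul c b = smul (of_real (Re c) + of_real (Im c) * \<i>) b"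
        using complex_eq[of c] by (simp add: mult.commute)
      also have "\<dots> = Re c *\<^sub>R b + Im c *\<^sub>R smul \<i> b"
        using 2 by (simp add: smul_add_left smul_of_real flip: smul_smul)
      also have "\<dots> \<in> span ?B" using that by (intro span_add span_scale span_base) auto
      finally show ?thesis .
    qed
  qed
  have "x \<in> span ?B" for x
  proof -
    obtain c where "\<forall>b\<in>B. c b \<in> F" "x = (\<Sum>b\<in>B. smul (c b) b)" using rep[of x] by blast
    then show ?thesis using term_in by (auto intro!: span_sum)
  qed
  then show ?thesis using B by (intro exI[of _ ?B]) auto
qed

text \<open>
  A relation \<open>x g(x) = 0\<close> can be divided by powers of \<open>x\<close> until \<open>g(0) \<noteq> 0\<close>, because no non-zero
  polynomial in the self-adjoint \<open>x\<close> is nilpotent. Solving for \<open>x\<close> then yields \<open>x = xf\<close> for a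
  projection \<open>f\<close>, the support of \<open>x\<close>, and an inverse \<open>y\<close> of \<open>x\<close> relative to \<open>f\<close>; being polynomials
  in \<open>x\<close>, both commute with everything that commutes with \<open>x\<close>.
\<close>

lemma support_projection:
  assumes "star x = x"
  shows "\<exists>f y. projection f \<and> f * x = x \<and> x * f = x \<and> x * y = f \<and> y * x = f \<and>
    (\<forall>z. z * x = x * z \<longrightarrow> z * f = f * z \<and> z * y = y * z)"
proof -
  let ?E = "horner x x"
  have comm: "z * ?E g = ?E g * z" if "z * x = x * z" for z g
    using horner_commutes that by blast
  have sa: "star (?E g) = ?E g" for g
  proof (induction g)
    case (pCons a g)
    then show ?case using assms comm[of x g] by (simp add: star_add star_scaleR star_mult)
  qed simp
  have cancel: "?E g = 0" if "x * ?E g = 0" for g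
  proof -
    have "?E g' * ?E g = 0" for g'
      by (induction g') (use that in \<open>auto simp: distrib_right mult.assoc\<close>)
    from this[of g] show ?thesis using sa star_mult_self_eq_0 by metis
  qed
  have low: "\<exists>a g'. a \<noteq> 0 \<and> a *\<^sub>R x + x * ?E g' = 0" if "g \<noteq> 0" "?E g = 0" for g
    using that
  proof (induction g)
    case (pCons a g)
    show ?case
    proof (cases "a = 0")
      case True
      then have "?E g = 0" using pCons.prems cancel by simp
      then show ?thesis using True pCons by auto
    next
      case False
      then show ?thesis using pCons.prems by auto
    qed
  qed simp
  obtain B where "finite B" "span B = (UNIV :: 'a set)" using finite_real_span by blast
  then obtain a g where ag: "a \<noteq> 0" "a *\<^sub>R x + x * ?E g = 0"
    using horner_annihilated low by meson
  let ?g = "smult (- 1 / a) g"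
  define f where "f = ?E ?g"
  have f: "f = - ((1 / a) *\<^sub>R ?E g)" by (simp only: f_def horner_smult) simp
  have "(1 / a) *\<^sub>R (a *\<^sub>R x + x * ?E g) = 0" using ag by simp
  then have "x + (1 / a) *\<^sub>R (x * ?E g) = 0" using ag(1) by (simp add: scaleR_add_right)
  then have xf: "x * f = x" by (simp add: f neg_eq_iff_add_eq_0 add.commute)
  have Ef: "?E g' * f = ?E g'" for g'
    using horner_absorb_right xf by blast
  have proj: "projection f" using Ef sa by (simp add: projection_def f_def)
  have fx: "f * x = x" using xf comm[of x ?g] by (simp add: f_def)
  obtain b k where bk: "?g = pCons b k" by (cases ?g)
  define y where "y = b *\<^sub>R f + ?E k"
  have fbk: "f = b *\<^sub>R x + x * ?E k" unfolding f_def bk by simp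
  have xy: "x * y = f" using fbk xf by (simp add: y_def distrib_left)
  have "z * f = f * z \<and> z * y = y * z" if "z * x = x * z" for z
    using comm[OF that, of ?g] comm[OF that, of k]
    by (simp add: f_def y_def distrib_left distrib_right)
  moreover from this[of x] xy have "y * x = f" by simp
  ultimately show ?thesis using proj fx xf xy by blast
qed

text \<open>
  If \<open>q\<close> does not split by projections commuting with \<open>h\<close>, then the support projection of a
  non-zero polynomial in \<open>x\<close> is \<open>q\<close>, so these polynomials form a field. A factor of degree one or
  two of an annihilating polynomial of least degree therefore annihilates \<open>x\<close> already, and a
  quadratic factor without real roots would produce an imaginary unit.
\<close>

lemma compression_scalar:
  assumes q: "projection q" "q \<noteq> 0"
    and unsplit: "\<And>f. projection f \<Longrightarrow> f * q = f \<Longrightarrow> f * h = h * f \<Longrightarrow> f = 0 \<or> f = q"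
    and x: "star x = x" "q * x = x" "x * q = x" "x * h = h * x"
    and qh: "q * h = h * q"
  shows "\<exists>r. x = r *\<^sub>R q"
proof -
  have qq: "q * q = q" and qs: "star q = q" using q by (auto simp: projection_def)
  have inverse: "\<exists>y. y * u = q"
    if u: "star u = u" "q * u = u" "u * q = u" "u * h = h * u" "u \<noteq> 0" for u
  proof -
    obtain f y where f: "projection f" "f * u = u" "u * y = f" "y * u = f"
      "\<And>z. z * u = u * z \<Longrightarrow> z * f = f * z"
      using support_projection[OF u(1)] by metis
    have "f * q = f" using f(5)[of q] u f(3) by (metis mult.assoc)
    moreover have "f * h = h * f" using f(5)[of h] u by metis
    ultimately have "f = q" using unsplit[OF f(1)] f(2) u(5) by force
    then show ?thesis using f by blast
  qed
  let ?E = "horner q x"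
  have E: "star (?E g) = ?E g" "q * ?E g = ?E g" "?E g * q = ?E g" "?E g * h = h * ?E g" for g
  proof -
    show "star (?E g) = ?E g"
    proof (induction g)
      case (pCons a g)
      then show ?case
        using x qs horner_commutes[of x q x g] by (simp add: star_add star_scaleR star_mult)
    qed simp
    show "q * ?E g = ?E g" using horner_absorb_left qq x by blast
    show "?E g * q = ?E g" using horner_absorb_right qq x by blast
    show "?E g * h = h * ?E g" using horner_commutes[of h q x g] qh x by metis
  qed
  obtain B where "finite B" "span B = (UNIV :: 'a set)" using finite_real_span by blast
  then have "\<exists>g. g \<noteq> 0 \<and> ?E g = 0" using horner_annihilated by blast
  then obtain g where g: "g \<noteq> 0" "?E g = 0"
    and least: "\<And>k. k \<noteq> 0 \<Longrightarrow> ?E k = 0 \<Longrightarrow> degree g \<le> degree k"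
    using ex_has_least_nat[of "\<lambda>g. g \<noteq> 0 \<and> ?E g = 0" _ degree] by blast
  have "degree g > 0"
  proof (rule ccontr)
    assume "\<not> degree g > 0"
    then obtain a where "g = [:a:]" using degree_eq_zeroE by blast
    then show False using g q by simp
  qed
  moreover have factor: "?E m = 0" if m: "m dvd g" and "degree m > 0" for m
  proof -
    obtain k where k: "g = m * k" using m by (rule dvdE)
    have nz: "m \<noteq> 0" "k \<noteq> 0" using k g by auto
    then have "degree g = degree m + degree k" using k by (simp add: degree_mult_eq)
    then have "?E k \<noteq> 0" using least nz that(2) by fastforce
    moreover have "?E m * ?E k = 0" using g k horner_mult[OF qq x(2)] by metis
    moreover obtain y where "y * ?E k = q" using inverse[OF E] \<open>?E k \<noteq> 0\<close> by blast
    ultimately have "?E k * ?E m = 0" using E(1) by (metis star_0 star_mult)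
    with \<open>y * ?E k = q\<close> have "q * ?E m = 0" by (metis mult.assoc mult_zero_right)
    then show ?thesis using E(2) by simp
  qed
  moreover have "degree [:c, 1:] > 0" "degree [:c, d, 1:] > 0" for c d :: real by simp_all
  ultimately obtain a b where ab: "?E [:-a, 1:] = 0 \<or> b \<noteq> 0 \<and> ?E [:a\<^sup>2 + b\<^sup>2, -2 * a, 1:] = 0"
    using real_poly_factor[of g] by meson
  have "x = a *\<^sub>R q" if "?E [:-a, 1:] = 0" using that x by simp
  moreover have False if b: "b \<noteq> 0" and E0: "?E [:a\<^sup>2 + b\<^sup>2, -2 * a, 1:] = 0"
  proof -
    define u where "u = (1 / b) *\<^sub>R (x - a *\<^sub>R q)"
    have "x * x = (2 * a) *\<^sub>R x - (a\<^sup>2 + b\<^sup>2) *\<^sub>R q"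
      using E0 x by (simp add: algebra_simps)
    then have "(x - a *\<^sub>R q) * (x - a *\<^sub>R q) = - (b\<^sup>2) *\<^sub>R q"
      using x qq by (simp add: algebra_simps power2_eq_square flip: scaleR_2)
    then have "u * u = - q" using b by (simp add: u_def power2_eq_square)
    moreover have "star u = u" using x qs by (simp add: u_def star_scaleR star_diff)
    moreover have "u * q = u" using x qq by (simp add: u_def left_diff_distrib)
    ultimately show False using no_imaginary_unit[OF q(1)] q(2) by blast
  qed
  ultimately show ?thesis using ab by blast
qed

lemma orthogonal_projections_independent:
  assumes "finite Q"
    and "\<And>q. q \<in> Q \<Longrightarrow> projection q \<and> q \<noteq> 0"
    and "\<And>q q'. q \<in> Q \<Longrightarrow> q' \<in> Q \<Longrightarrow> q \<noteq> q' \<Longrightarrow> q * q' = 0"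
  shows "independent Q"
proof
  assume "dependent Q"
  then obtain u v where uv: "v \<in> Q" "u v \<noteq> 0" "(\<Sum>q\<in>Q. u q *\<^sub>R q) = 0"
    using dependent_finite[OF assms(1)] by auto
  have "v * (\<Sum>q\<in>Q. u q *\<^sub>R q) = (\<Sum>q\<in>Q. if q = v then u v *\<^sub>R v else 0)"
    unfolding sum_distrib_left
  proof (rule sum.cong)
    fix q assume "q \<in> Q"
    then show "v * (u q *\<^sub>R q) = (if q = v then u v *\<^sub>R v else 0)"
      using assms(2)[of v] assms(3)[of v q] uv(1) by (auto simp: projection_def)
  qed simp
  then have "u v *\<^sub>R v = 0" using uv(1,3) assms(1) by simp
  then show False using uv assms(2) by simp
qed

lemma norm_orthogonal_combination_le:
  assumes "finite Q"
    and "\<And>q. q \<in> Q \<Longrightarrow> projection q"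
    and "\<And>q q'. q \<in> Q \<Longrightarrow> q' \<in> Q \<Longrightarrow> q \<noteq> q' \<Longrightarrow> q * q' = 0"
    and "\<And>q. q \<in> Q \<Longrightarrow> \<bar>lam q\<bar> \<le> M" and "0 \<le> M"
  shows "norm (\<Sum>q\<in>Q. lam q *\<^sub>R q) \<le> M"
  using assms(1-4)
proof (induction Q)
  case (insert q Q)
  have star_q: "star q' = q'" if "q' \<in> insert q Q" for q'
    using insert.prems(1)[OF that] by (simp add: projection_def)
  have "norm (lam q *\<^sub>R q + (\<Sum>q\<in>Q. lam q *\<^sub>R q)) \<le> M"
  proof (rule norm_add_self_adjoint_le)
    show "star (lam q *\<^sub>R q) = lam q *\<^sub>R q" using star_q by (simp add: star_scaleR)
    show "star (\<Sum>q\<in>Q. lam q *\<^sub>R q) = (\<Sum>q\<in>Q. lam q *\<^sub>R q)"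
      using star_q by (auto simp: star_sum star_scaleR intro!: sum.cong)
    have "q * q' = 0" if "q' \<in> Q" for q' using insert that by auto
    then show "lam q *\<^sub>R q * (\<Sum>q\<in>Q. lam q *\<^sub>R q) = 0"
      by (simp add: sum_distrib_left)
    show "norm (\<Sum>q\<in>Q. lam q *\<^sub>R q) \<le> M" using insert by blast
    show "norm (lam q *\<^sub>R q) \<le> M"
      using norm_projection[of q] insert.prems(1,3)[of q] assms(5) by (cases "q = 0") auto
  qed
  then show ?case using insert.hyps by simp
qed (use assms(5) in simp)

text \<open>
  A family of orthogonal projections that commute with \<open>h\<close> and has the largest possible size
  cannot be refined or enlarged. Therefore \<open>h\<close> is a scalar \<open>\<lambda>\<close> on each member \<open>q\<close>, so that
  everything in \<open>qAq\<close> commutes with \<open>h\<close> and \<open>q\<close> is minimal in the whole algebra; and \<open>h\<close>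
  vanishes off the sum of the family.
\<close>

theorem spectral_decomposition:
  assumes h: "star h = h"
  shows "\<exists>Q lam. finite Q \<and> (\<forall>q\<in>Q. minimal_projection q) \<and>
    (\<forall>q\<in>Q. \<forall>q'\<in>Q. q \<noteq> q' \<longrightarrow> q * q' = 0) \<and> h = (\<Sum>q\<in>Q. lam q *\<^sub>R q)"
proof -
  define family where "family Q \<longleftrightarrow> finite Q \<and>
    (\<forall>q\<in>Q. q \<noteq> 0 \<and> projection q \<and> q * h = h * q) \<and>
    (\<forall>q\<in>Q. \<forall>q'\<in>Q. q \<noteq> q' \<longrightarrow> q * q' = 0)" for Q
  obtain B where B: "finite B" "span B = (UNIV :: 'a set)" using finite_real_span by blast
  have "card Q \<le> card B" if "family Q" for Q
  proof -
    have "independent Q"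
      by (rule orthogonal_projections_independent) (use that in \<open>auto simp: family_def\<close>)
    then show ?thesis using independent_span_bound[OF B(1), of Q] B(2) by simp
  qed
  moreover have "family {}" by (simp add: family_def)
  ultimately obtain Q where Q: "family Q" and largest: "\<And>Q'. family Q' \<Longrightarrow> card Q' \<le> card Q"
    using ex_has_greatest_nat[of family "{}" card "Suc (card B)"]
    by (meson le_imp_less_Suc)
  have finQ: "finite Q" using Q by (simp add: family_def)
  have proj: "projection q" "q \<noteq> 0" "q * h = h * q" "q * q = q" "star q = q" if "q \<in> Q" for q
    using Q that by (auto simp: family_def projection_def)
  have orth: "q * q' = 0" if "q \<in> Q" "q' \<in> Q" "q \<noteq> q'" for q q'
    using Q that by (simp add: family_def)
  have unsplit: "f = 0 \<or> f = q"
    if q: "q \<in> Q" and f: "projection f" "f * q = f" "f * h = h * f" for f q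
  proof (rule ccontr)
    assume nontrivial: "\<not> (f = 0 \<or> f = q)"
    have qf: "q * f = f" using projection_absorb proj(1)[OF q] f by blast
    have ff: "f * f = f" "star f = f" using f(1) by (auto simp: projection_def)
    have g: "projection (q - f)" "(q - f) * h = h * (q - f)" "f * (q - f) = 0" "(q - f) * f = 0"
      using proj[OF q] f qf ff
      by (auto simp: projection_def star_diff left_diff_distrib right_diff_distrib)
    have f_orth: "f * q' = 0" "q' * f = 0" if "q' \<in> Q - {q}" for q'
    proof -
      have "q * q' = 0" "q' * q = 0" using orth q that by auto
      then show "f * q' = 0" "q' * f = 0" using f(2) qf
        by (metis mult.assoc mult_zero_right, metis mult.assoc mult_zero_left)
    qed
    have g_orth: "(q - f) * q' = 0" "q' * (q - f) = 0" if "q' \<in> Q - {q}" for q'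
      using that f_orth[OF that] orth[OF q, of q'] orth[of q' q] q
      by (auto simp: left_diff_distrib right_diff_distrib)
    let ?Q = "insert f (insert (q - f) (Q - {q}))"
    have fam: "family ?Q"
      using nontrivial proj f g f_orth g_orth orth finQ unfolding family_def by auto
    have "f \<notin> Q - {q}" "q - f \<notin> Q - {q}" "f \<noteq> q - f"
    proof -
      show "f \<notin> Q - {q}" using f_orth(1)[of f] ff nontrivial by auto
      show "q - f \<notin> Q - {q}" using g_orth(1)[of "q - f"] g(1) nontrivial
        by (auto simp: projection_def)
      show "f \<noteq> q - f" using g(3) ff nontrivial by metis
    qed
    then have "card ?Q = Suc (Suc (card (Q - {q})))" using finQ by simp
    moreover have "card Q = Suc (card (Q - {q}))" by (rule card.remove[OF finQ q])
    ultimately show False using largest[OF fam] by linarith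
  qed
  have "\<exists>r. h * q = r *\<^sub>R q" if q: "q \<in> Q" for q
  proof (rule compression_scalar[OF proj(1,2)[OF q]])
    show "f = 0 \<or> f = q" if "projection f" "f * q = f" "f * h = h * f" for f
      using unsplit[OF q] that by blast
    show "star (h * q) = h * q" using proj[OF q] h by (simp add: star_mult)
    show "q * (h * q) = h * q" using proj[OF q] by (metis mult.assoc)
    show "h * q * q = h * q" using proj[OF q] by (metis mult.assoc)
    show "h * q * h = h * (h * q)" using proj[OF q] by (metis mult.assoc)
    show "q * h = h * q" using proj[OF q] by blast
  qed
  then obtain lam where lam: "\<And>q. q \<in> Q \<Longrightarrow> h * q = lam q *\<^sub>R q" by metis
  have "minimal_projection q" if q: "q \<in> Q" for q
    unfolding minimal_projection_def
  proof (intro conjI allI impI)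
    fix x assume x: "star x = x" "q * x = x" "x * q = x"
    have "h * x = lam q *\<^sub>R x" using lam[OF q] x(2) by (metis mult.assoc mult_scaleR_left)
    moreover have "x * h = lam q *\<^sub>R x"
      using lam[OF q] proj(3)[OF q] x(3) by (metis mult.assoc mult_scaleR_right)
    ultimately have "x * h = h * x" by simp
    then show "\<exists>r. x = r *\<^sub>R q"
      using compression_scalar[OF proj(1,2)[OF q], of h x] unsplit[OF q] x proj(3)[OF q] by blast
  qed (use proj[OF q] in auto)
  moreover have "h = (\<Sum>q\<in>Q. lam q *\<^sub>R q)"
  proof (rule ccontr)
    define d where "d = h - (\<Sum>q\<in>Q. lam q *\<^sub>R q)"
    assume "h \<noteq> (\<Sum>q\<in>Q. lam q *\<^sub>R q)"
    then have "d \<noteq> 0" by (simp add: d_def)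
    have d_sa: "star d = d"
      using h proj(5) by (auto simp: d_def star_diff star_sum star_scaleR intro!: sum.cong)
    have hd: "h * d = d * h"
      using proj(3) by (auto simp: d_def left_diff_distrib right_diff_distrib
          sum_distrib_left sum_distrib_right intro!: sum.cong)
    have dq: "d * q = 0" if q: "q \<in> Q" for q
    proof -
      have "(\<Sum>q'\<in>Q. lam q' *\<^sub>R q') * q = (\<Sum>q'\<in>Q. if q' = q then lam q *\<^sub>R q else 0)"
        unfolding sum_distrib_right
        using proj(4)[OF q] orth q by (intro sum.cong) auto
      then show ?thesis using lam[OF q] q finQ by (simp add: d_def left_diff_distrib)
    qed
    obtain f y where f: "projection f" "f * d = d" "y * d = f"
      "\<And>z. z * d = d * z \<Longrightarrow> z * f = f * z"
      using support_projection[OF d_sa] by metis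
    have fq: "f * q = 0" if "q \<in> Q" for q
      using dq[OF that] f(3) by (metis mult.assoc mult_zero_right)
    have qf: "q * f = 0" if "q \<in> Q" for q
      using projection_orthogonal[OF f(1) proj(1)[OF that] fq[OF that]] .
    have "f \<noteq> 0" using f(2) \<open>d \<noteq> 0\<close> by auto
    moreover have "f * h = h * f" using f(4)[OF hd] by simp
    ultimately have "family (insert f Q)"
      using Q f(1) fq qf unfolding family_def by auto
    moreover have "f \<notin> Q" using fq[of f] f(1) \<open>f \<noteq> 0\<close> by (auto simp: projection_def)
    ultimately show False using largest[of "insert f Q"] finQ by simp
  qed
  ultimately show ?thesis using finQ orth by blast
qed

lemma minimal_projectionD:
  assumes "minimal_projection p"
  shows "p * p = p" "star p = p" "p \<noteq> 0" "norm p = 1" "projection p"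
  using assms norm_projection by (auto simp: minimal_projection_def projection_def)

lemma minimal_projection_scalar:
  assumes "minimal_projection p" "star x = x" "p * x = x" "x * p = x"
  obtains r where "x = r *\<^sub>R p"
  using assms unfolding minimal_projection_def by blast

lemma norm_attained_on_minimal_projection:
  assumes "star h = h" "h \<noteq> 0"
  obtains p r where "minimal_projection p" "h * p = r *\<^sub>R p" "norm h \<le> \<bar>r\<bar>"
proof -
  obtain Q lam where Q: "finite Q" "\<And>q. q \<in> Q \<Longrightarrow> minimal_projection q"
    "\<And>q q'. q \<in> Q \<Longrightarrow> q' \<in> Q \<Longrightarrow> q \<noteq> q' \<Longrightarrow> q * q' = 0" and h: "h = (\<Sum>q\<in>Q. lam q *\<^sub>R q)"
    using spectral_decomposition[OF assms(1)] by metis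
  have "Q \<noteq> {}" using h assms(2) by auto
  define M where "M = Max ((\<lambda>q. \<bar>lam q\<bar>) ` Q)"
  have bound: "\<bar>lam q\<bar> \<le> M" if "q \<in> Q" for q using that Q(1) by (simp add: M_def)
  have "M \<in> (\<lambda>q. \<bar>lam q\<bar>) ` Q" using Q(1) \<open>Q \<noteq> {}\<close> unfolding M_def by (intro Max_in) auto
  then obtain p where p: "p \<in> Q" "\<bar>lam p\<bar> = M" by auto
  have "norm h \<le> M" unfolding h
    by (rule norm_orthogonal_combination_le) (use Q minimal_projectionD(5) bound p in auto)
  moreover have "h * p = (\<Sum>q\<in>Q. if q = p then lam p *\<^sub>R p else 0)"
    unfolding h sum_distrib_right
    using Q(3) p minimal_projectionD(1)[OF Q(2)[OF p(1)]] by (intro sum.cong) auto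
  then have "h * p = lam p *\<^sub>R p" using Q(1) p by simp
  ultimately show thesis using that Q(2) p by metis
qed

section \<open>Positivity at minimal projections\<close>

text \<open>
  If \<open>t\<^sup>*t = -p\<close>, then \<open>-tt\<^sup>*\<close> is a projection orthogonal to \<open>p\<close>, and \<open>t + t\<^sup>*\<close> is an imaginary unit
  for the sum \<open>p - tt\<^sup>*\<close>.
\<close>

lemma off_diagonal_not_negative:
  assumes p: "minimal_projection p" and t: "p * t = 0" "t * p = t"
  shows "star t * t \<noteq> - p"
proof
  assume tt: "star t * t = - p"
  note pD = minimal_projectionD[OF p]
  have st: "star t * p = 0" "p * star t = star t"
    using t pD(2) star_mult star_0 by metis+
  have t0: "t * t = 0" using t by (metis mult.assoc mult_zero_right)
  have st0: "star t * star t = 0" using t0 star_mult star_0 by metis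
  let ?e = "p - t * star t" and ?y = "t + star t"
  have stt: "star t * (t * z) = - (p * z)" for z
    using tt by (metis mult.assoc mult_minus_left)
  have e1: "t * star t * p = 0" "p * (t * star t) = 0"
    using st t by (metis mult.assoc mult_zero_right, metis mult.assoc mult_zero_left)
  have e2: "t * star t * (t * star t) = - (t * star t)"
    using stt st by (simp add: mult.assoc)
  have "projection ?e"
    using e1 e2 pD by (simp add: projection_def star_diff star_mult star_star algebra_simps)
  moreover have "star ?y = ?y" by (simp add: star_add star_star add.commute)
  moreover have "?y * ?y = - ?e" using tt t0 st0 by (simp add: algebra_simps)
  moreover have "?y * ?e = ?y"
  proof -
    have "t * (t * star t) = 0" using t0 by (metis mult.assoc mult_zero_left)
    then show ?thesis using stt st t by (simp add: distrib_right right_diff_distrib)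
  qed
  ultimately have "?e = 0" by (rule no_imaginary_unit)
  then have "?e * p = 0" by simp
  then show False using e1 pD by (simp add: left_diff_distrib)
qed

text \<open>Over the complex scalars \<open>pAp\<close> consists of the complex multiples of \<open>p\<close>.\<close>

lemma square_in_compression:
  assumes p: "minimal_projection p" and F: "F = UNIV" and x: "p * x = x" "x * p = x"
  shows "\<exists>m\<ge>0. star x * x = m *\<^sub>R p"
proof -
  note pD = minimal_projectionD[OF p]
  have sx: "p * star x = star x" "star x * p = star x" using x pD(2) star_mult by metis+
  have conj: "star (smul c z) = smul (cnj c) (star z)" for c z using F star_smul by simp
  define k where "k = smul (- \<i>) (x - star x)"
  have ik: "smul \<i> k = x - star x" using F by (simp add: k_def smul_smul)
  have "star k = smul \<i> (star x - x)" by (simp add: k_def conj star_diff star_star)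
  also have "\<dots> = smul \<i> (smul (-1) (x - star x))"
    using smul_of_real[of "-1"] by simp
  finally have "star k = k" using F by (simp add: k_def smul_smul)
  moreover have "p * k = k" "k * p = k"
    using F x sx by (simp_all add: k_def smul_mult_left smul_mult_right left_diff_distrib right_diff_distrib)
  ultimately obtain s where s: "k = s *\<^sub>R p" using minimal_projection_scalar[OF p] by blast
  have "star (x + star x) = x + star x" by (simp add: star_add star_star add.commute)
  moreover have "p * (x + star x) = x + star x" "(x + star x) * p = x + star x"
    using x sx by (simp_all add: distrib_left distrib_right)
  ultimately obtain r where r: "x + star x = r *\<^sub>R p" using minimal_projection_scalar[OF p] by blast
  let ?c = "Complex (r / 2) (s / 2)"
  have "2 *\<^sub>R x = (x + star x) + (x - star x)" by (simp add: scaleR_2)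
  also have "\<dots> = smul (of_real r) p + smul \<i> (smul (of_real s) p)"
    using r ik s by (simp add: smul_of_real)
  also have "\<dots> = smul (of_real r + \<i> * of_real s) p" using F by (simp add: smul_add_left smul_smul)
  also have "of_real r + \<i> * of_real s = of_real 2 * ?c" by (simp add: complex_eq_iff)
  also have "smul (of_real 2 * ?c) p = 2 *\<^sub>R smul ?c p"
    using F smul_smul smul_of_real by (metis UNIV_I)
  finally have xc: "x = smul ?c p" by simp
  have "star x * x = smul (cnj ?c * ?c) p"
    using F pD unfolding xc by (simp add: conj smul_mult_left smul_mult_right smul_smul mult.commute)
  also have "cnj ?c * ?c = of_real ((cmod ?c)\<^sup>2)" by (metis complex_norm_square mult.commute)
  finally show ?thesis by (metis smul_of_real zero_le_power2)
qed

text \<open>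
  The element \<open>x\<^sup>*x\<close> is a real multiple \<open>cp\<close>, and only the sign of \<open>c\<close> is at stake. Over the real
  scalars \<open>c < 0\<close> would contradict the invertibility of \<open>1 + t\<^sup>*t\<close> for a multiple \<open>t\<close> of \<open>x\<close>. Over
  the complex scalars \<open>x\<^sup>*x\<close> is the sum of the contributions of \<open>px\<close> and of \<open>x - px\<close>, which are
  non-negative by the two preceding lemmas.
\<close>

lemma star_mult_self_minimal:
  assumes p: "minimal_projection p" and x: "x * p = x"
  shows "star x * x = (norm x)\<^sup>2 *\<^sub>R p"
proof -
  note pD = minimal_projectionD[OF p]
  have sx: "p * star x = star x" using x pD(2) star_mult by metis
  have scalar: "\<exists>c. star y * y = c *\<^sub>R p" if "y * p = y" for y
  proof -
    have "p * star y = star y" using that pD(2) star_mult by metis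
    then show ?thesis
      using minimal_projection_scalar[OF p, of "star y * y"] that star_mult star_star
      by (metis mult.assoc)
  qed
  have off: "c \<ge> 0" if "p * y = 0" "y * p = y" "star y * y = c *\<^sub>R p" for y c
  proof (rule ccontr)
    assume c: "\<not> c \<ge> 0"
    let ?t = "(1 / sqrt (- c)) *\<^sub>R y"
    have "star ?t * ?t = - p"
      using that(3) c by (simp add: star_scaleR flip: real_sqrt_mult)
    moreover have "p * ?t = 0" "?t * p = ?t" using that by simp_all
    ultimately show False using off_diagonal_not_negative[OF p] by blast
  qed
  obtain c where c: "star x * x = c *\<^sub>R p" using scalar[OF x] by blast
  have "c \<ge> 0"
  proof (rule ccontr)
    assume neg: "\<not> c \<ge> 0"
    consider "F = \<real>" | "F = UNIV" using scalars by blast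
    then show False
    proof cases
      case 1
      let ?t = "(1 / sqrt (- c)) *\<^sub>R x"
      have "star ?t * ?t = - p"
        using c neg by (simp add: star_scaleR flip: real_sqrt_mult)
      then obtain b where "- p + b + - p * b = 0" using real_cstar[OF 1, of ?t] by auto
      then have "p * (- p + b + - p * b) = 0" by simp
      then show False using pD by (simp add: distrib_left right_diff_distrib flip: mult.assoc)
    next
      case 2
      have "p * (p * x) = p * x" "p * x * p = p * x" using pD x by (simp_all add: mult.assoc flip: mult.assoc[of p p])
      then obtain m where m: "m \<ge> 0" "star (p * x) * (p * x) = m *\<^sub>R p"
        using square_in_compression[OF p 2] by blast
      let ?t = "x - p * x"
      have pxx: "star (p * x) * (p * x) = star x * (p * x)"
        using pD by (simp add: star_mult mult.assoc flip: mult.assoc[of p p])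
      have "star ?t * ?t = star x * x - star (p * x) * (p * x)"
        using pD unfolding pxx
        by (simp add: star_diff star_mult left_diff_distrib right_diff_distrib mult.assoc flip: mult.assoc[of p p])
      also have "\<dots> = (c - m) *\<^sub>R p" using c m by (simp add: scaleR_diff_left)
      finally have "c - m \<ge> 0"
        by (rule off[rotated 2]) (use pD x in \<open>simp_all add: left_diff_distrib right_diff_distrib mult.assoc flip: mult.assoc[of p p]\<close>)
      then show False using m neg by simp
    qed
  qed
  moreover have "(norm x)\<^sup>2 = \<bar>c\<bar>" using cstar_identity[of x] c pD(4) by simp
  ultimately show ?thesis using c by simp
qed

section \<open>Sums of minimal ideals\<close>

lemma ideal_scaleR:
  assumes "two_sided_ideal F smul I" "x \<in> I"
  shows "r *\<^sub>R x \<in> I"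
  using assms unfolding two_sided_ideal_def by (metis of_real_in_scalars smul_of_real)

lemma ideal_inter:
  assumes "two_sided_ideal F smul I" "two_sided_ideal F smul J"
  shows "two_sided_ideal F smul (I \<inter> J)"
  using assms unfolding two_sided_ideal_def by auto

lemma ideal_star_image:
  assumes "two_sided_ideal F smul I"
  shows "two_sided_ideal F smul (star ` I)"
  unfolding two_sided_ideal_def
proof (intro conjI ballI allI)
  have mem: "x \<in> star ` I \<longleftrightarrow> star x \<in> I" for x
    by (metis image_iff star_star)
  show "0 \<in> star ` I" using assms by (simp add: mem two_sided_ideal_def)
  show "x + y \<in> star ` I" if "x \<in> star ` I" "y \<in> star ` I" for x y
    using assms that by (simp add: mem two_sided_ideal_def star_add)
  show "smul c x \<in> star ` I" if "c \<in> F" "x \<in> star ` I" for c x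
    using assms that by (simp add: mem two_sided_ideal_def star_smul cnj_in_scalars)
  show "a * x \<in> star ` I" "x * a \<in> star ` I" if "x \<in> star ` I" for a x
    using assms that by (simp_all add: mem two_sided_ideal_def star_mult)
qed

lemma minimal_ideals_product:
  assumes "minimal_ideal F smul I" "minimal_ideal F smul J" "I \<noteq> J" "x \<in> I" "y \<in> J"
  shows "x * y = 0"
proof -
  have "two_sided_ideal F smul (I \<inter> J)"
    using assms ideal_inter by (simp add: minimal_ideal_def)
  then have "I \<inter> J = {0}"
    using assms unfolding minimal_ideal_def by (metis inf.cobounded1 inf.cobounded2)
  moreover have "x * y \<in> I \<inter> J"
    using assms by (auto simp: minimal_ideal_def two_sided_ideal_def)
  ultimately show ?thesis by blast
qed

text \<open>
  The adjoints of a minimal ideal \<open>I\<close> form a minimal ideal, which is not orthogonal to \<open>I\<close>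
  because \<open>xx\<^sup>* \<noteq> 0\<close>.
\<close>

lemma minimal_ideal_star_closed:
  assumes I: "minimal_ideal F smul I" and x: "x \<in> I"
  shows "star x \<in> I"
proof (cases "x = 0")
  case False
  have star2: "star ` star ` J = J" for J by (simp add: image_image star_star)
  have zero: "star ` J = {0} \<longleftrightarrow> J = {0}" for J
    by (metis image_empty image_insert star2 star_0)
  have "minimal_ideal F smul (star ` I)"
    unfolding minimal_ideal_def
  proof (intro conjI allI impI)
    show "two_sided_ideal F smul (star ` I)" "star ` I \<noteq> {0}"
      using I ideal_star_image zero by (auto simp: minimal_ideal_def)
    fix J assume J: "two_sided_ideal F smul J" "J \<subseteq> star ` I"
    have "star ` J \<subseteq> I" using J(2) star2 image_mono by metis
    then have "star ` J = {0} \<or> star ` J = I"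
      using I J(1) ideal_star_image by (auto simp: minimal_ideal_def)
    then show "J = {0} \<or> J = star ` I" using zero star2 by metis
  qed
  moreover have "star (star x) * star x \<noteq> 0" using False by (simp add: star_mult_self_eq_0)
  ultimately have "star ` I = I"
    using minimal_ideals_product[OF I, of "star ` I" x "star x"] x by (auto simp: star_star)
  then show ?thesis using x by blast
qed (use x in simp)

lemma linear_operations:
  fixes a :: 'a
  shows "linear star" and "linear ((*) a)" and "linear (\<lambda>x. x * a)"
    and "c \<in> F \<Longrightarrow> linear (smul c)"
proof -
  show "linear star" by (rule linearI) (simp_all add: star_add star_scaleR)
  show "linear ((*) a)" by (rule linearI) (simp_all add: distrib_left)
  show "linear (\<lambda>x. x * a)" by (rule linearI) (simp_all add: distrib_right)
  assume c: "c \<in> F"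
  then have "smul c (r *\<^sub>R x) = r *\<^sub>R smul c x" for r x
    by (metis mult.commute of_real_in_scalars smul_of_real smul_smul)
  then show "linear (smul c)" by (intro linearI) (simp_all add: smul_add_right c)
qed

lemma linear_preserves_span:
  assumes "linear g" "\<And>x. x \<in> S \<Longrightarrow> g x \<in> span S" "x \<in> span S"
  shows "g x \<in> span S"
proof -
  have "g ` span S = span (g ` S)" using assms(1) by (simp add: linear_span_image)
  also have "\<dots> \<subseteq> span S" using assms(2) by (intro span_minimal) auto
  finally show ?thesis using assms(3) by blast
qed

text \<open>
  A non-zero ideal \<open>J\<close> inside the ideal generated by a minimal projection \<open>p\<close> contains some
  non-zero \<open>paj\<close>; then \<open>(paj)(paj)\<^sup>*\<close> is a non-zero multiple of \<open>p\<close>.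
\<close>

lemma minimal_projection_in_minimal_ideal:
  assumes p: "minimal_projection p"
  shows "\<exists>I. minimal_ideal F smul I \<and> p \<in> I"
proof -
  note pD = minimal_projectionD[OF p]
  define G where "G = {a * p * b | a b. True}"
  have G: "a * p * b \<in> span G" for a b by (rule span_base) (auto simp: G_def)
  have ideal: "two_sided_ideal F smul (span G)"
    unfolding two_sided_ideal_def
  proof (intro conjI ballI allI)
    show "smul c x \<in> span G" if "c \<in> F" "x \<in> span G" for c x
      using linear_operations(4)[OF that(1)] _ that(2)
    proof (rule linear_preserves_span)
      fix x assume "x \<in> G"
      then obtain a b where "x = a * p * b" by (auto simp: G_def)
      then have "smul c x = smul c a * p * b" using that by (simp add: smul_mult_left)
      then show "smul c x \<in> span G" using G by simp
    qed
    show "a * x \<in> span G" if "x \<in> span G" for a x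
      using linear_operations(2) _ that
    proof (rule linear_preserves_span)
      fix x assume "x \<in> G"
      then obtain c d where "x = c * p * d" by (auto simp: G_def)
      then have "a * x = (a * c) * p * d" by (simp add: mult.assoc)
      then show "a * x \<in> span G" using G by simp
    qed
    show "x * a \<in> span G" if "x \<in> span G" for a x
      using linear_operations(3) _ that
    proof (rule linear_preserves_span)
      fix x assume "x \<in> G"
      then obtain c d where "x = c * p * d" by (auto simp: G_def)
      then have "x * a = c * p * (d * a)" by (simp add: mult.assoc)
      then show "x * a \<in> span G" using G by simp
    qed
  qed (auto simp: span_0 span_add)
  have pG: "p \<in> span G" using G[of p p] pD(1) by simp
  have "J = span G" if J: "two_sided_ideal F smul J" "J \<subseteq> span G" "J \<noteq> {0}" for J
  proof -
    obtain j where j: "j \<in> J" "j \<noteq> 0" using J by (auto simp: two_sided_ideal_def)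
    have "\<exists>a. p * a * j \<noteq> 0"
    proof (rule ccontr)
      assume none: "\<not> (\<exists>a. p * a * j \<noteq> 0)"
      have "star j \<in> {x. x * j = 0}" if "star j \<in> span G"
      proof (rule span_minimal[THEN subsetD, OF _ _ that])
        show "G \<subseteq> {x. x * j = 0}" using none by (auto simp: G_def mult.assoc)
        show "subspace {x. x * j = 0}" by (auto simp: subspace_def distrib_right)
      qed
      moreover have "star j \<in> span G"
        using linear_operations(1)
      proof (rule linear_preserves_span)
        fix x assume "x \<in> G"
        then obtain c d where "x = c * p * d" by (auto simp: G_def)
        then have "star x = star d * p * star c" using pD(2) by (simp add: star_mult mult.assoc)
        then show "star x \<in> span G" using G by simp
      qed (use j J in auto)
      ultimately show False using j(2) by (simp add: star_mult_self_eq_0)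
    qed
    then obtain a where a: "p * a * j \<noteq> 0" by blast
    let ?y = "star (p * a * j)"
    have "?y * p = ?y" using pD by (simp add: star_mult mult.assoc)
    then have "star ?y * ?y = (norm ?y)\<^sup>2 *\<^sub>R p" using star_mult_self_minimal[OF p] by blast
    moreover have "star ?y * ?y \<in> J"
      using j(1) J(1) by (simp add: star_star two_sided_ideal_def)
    ultimately have "(norm ?y)\<^sup>2 *\<^sub>R p \<in> J" by simp
    then have "(1 / (norm ?y)\<^sup>2) *\<^sub>R ((norm ?y)\<^sup>2 *\<^sub>R p) \<in> J" by (rule ideal_scaleR[OF J(1)])
    moreover have "norm ?y \<noteq> 0" using a by simp
    ultimately have "p \<in> J" by simp
    then have "G \<subseteq> J" using J(1) by (auto simp: G_def two_sided_ideal_def)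
    moreover have "subspace J"
      using J(1) ideal_scaleR[OF J(1)] by (auto simp: subspace_def two_sided_ideal_def)
    ultimately show ?thesis using J(2) span_minimal by blast
  qed
  then have "minimal_ideal F smul (span G)"
    using ideal pG pD(3) unfolding minimal_ideal_def by blast
  then show ?thesis using pG by blast
qed

lemma sum_of_minimal_ideals_closed:
  assumes S: "\<And>I. I \<in> S \<Longrightarrow> minimal_ideal F smul I" and x: "x \<in> span (\<Union>S)"
  shows "star x \<in> span (\<Union>S)" and "c \<in> F \<Longrightarrow> smul c x \<in> span (\<Union>S)"
proof -
  have ideal: "two_sided_ideal F smul I" if "I \<in> S" for I
    using S[OF that] by (simp add: minimal_ideal_def)
  show "star x \<in> span (\<Union>S)"
    using linear_operations(1) _ x
    by (rule linear_preserves_span) (use S minimal_ideal_star_closed in \<open>auto intro!: span_base\<close>)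
  show "smul c x \<in> span (\<Union>S)" if "c \<in> F"
    using linear_operations(4)[OF that] _ x
    by (rule linear_preserves_span) (use ideal that in \<open>auto intro!: span_base simp: two_sided_ideal_def\<close>)
qed

lemma sums_of_minimal_ideals_product:
  assumes S: "\<And>I. I \<in> S \<Longrightarrow> minimal_ideal F smul I"
    and T: "\<And>I. I \<in> T \<Longrightarrow> minimal_ideal F smul I"
    and "S \<inter> T = {}" and x: "x \<in> span (\<Union>S)" and y: "y \<in> span (\<Union>T)"
  shows "x * y = 0"
proof -
  have *: "u * y = 0" if u: "u \<in> \<Union>S" for u
  proof -
    have "y \<in> {y. u * y = 0}"
    proof (rule span_minimal[THEN subsetD, OF _ _ y])
      show "\<Union>T \<subseteq> {y. u * y = 0}"
      proof
        fix y assume "y \<in> \<Union>T"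
        then obtain I J where "I \<in> S" "u \<in> I" "J \<in> T" "y \<in> J" using u by blast
        moreover from this have "I \<noteq> J" using assms(3) by blast
        ultimately show "y \<in> {y. u * y = 0}" using minimal_ideals_product S T by blast
      qed
      show "subspace {y. u * y = 0}" by (auto simp: subspace_def distrib_left)
    qed
    then show ?thesis by simp
  qed
  have "x \<in> {x. x * y = 0}"
    by (rule span_minimal[THEN subsetD, OF _ _ x]) (use * in \<open>auto simp: subspace_def distrib_right\<close>)
  then show ?thesis by simp
qed

text \<open>
  Every \<open>w\<close> equals \<open>we\<close>, where \<open>e\<close> is the sum of the minimal projections that diagonalise
  \<open>w\<^sup>*w\<close>. So the algebra is the sum of its minimal ideals.
\<close>

lemma in_sum_of_minimal_ideals: "w \<in> span (\<Union>{I. minimal_ideal F smul I})"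
proof -
  have "star (star w * w) = star w * w" by (simp add: star_mult star_star)
  from spectral_decomposition[OF this] obtain Q lam where Q: "finite Q" "\<And>q. q \<in> Q \<Longrightarrow> minimal_projection q"
    "\<And>q q'. q \<in> Q \<Longrightarrow> q' \<in> Q \<Longrightarrow> q \<noteq> q' \<Longrightarrow> q * q' = 0"
    and ww: "star w * w = (\<Sum>q\<in>Q. lam q *\<^sub>R q)"
    by metis
  define e where "e = sum id Q"
  have qe: "q * e = q" if "q \<in> Q" for q
  proof -
    have "q * e = (\<Sum>q'\<in>Q. if q' = q then q else 0)"
      unfolding e_def sum_distrib_left
      using Q(3)[OF that] minimal_projectionD(1)[OF Q(2)[OF that]] by (intro sum.cong) auto
    then show ?thesis using Q(1) that by simp
  qed
  have "star w * w * e = star w * w"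
    unfolding ww sum_distrib_right by (intro sum.cong) (simp_all add: qe)
  then have "star w * (w - w * e) = 0" by (simp add: right_diff_distrib mult.assoc)
  then have "star (w - w * e) * (w - w * e) = 0"
    by (simp add: star_diff star_mult left_diff_distrib mult.assoc)
  then have "w = (\<Sum>q\<in>Q. w * q)"
    by (simp add: star_mult_self_eq_0 e_def sum_distrib_left)
  moreover have "w * q \<in> span (\<Union>{I. minimal_ideal F smul I})" if q: "q \<in> Q" for q
  proof -
    obtain I where "minimal_ideal F smul I" "q \<in> I"
      using minimal_projection_in_minimal_ideal[OF Q(2)[OF q]] by blast
    then have "minimal_ideal F smul I" "w * q \<in> I"
      by (auto simp: minimal_ideal_def two_sided_ideal_def)
    then show ?thesis by (intro span_base) blast
  qed
  then have "(\<Sum>q\<in>Q. w * q) \<in> span (\<Union>{I. minimal_ideal F smul I})" by (rule span_sum)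
  ultimately show ?thesis by metis
qed

lemma pseudo_abelian_decomposition:
  obtains x y where "x \<in> pseudo_abelian_summand F smul" "y \<in> nonpseudo_abelian_summand F smul"
    "w = x + y"
proof -
  have "\<Union>{I. minimal_ideal F smul I} = \<Union>{I. minimal_ideal F smul I \<and> skew_field_ideal I} \<union>
      \<Union>{I. minimal_ideal F smul I \<and> \<not> skew_field_ideal I}" by blast
  then have "w \<in> span (\<Union>{I. minimal_ideal F smul I \<and> skew_field_ideal I} \<union>
      \<Union>{I. minimal_ideal F smul I \<and> \<not> skew_field_ideal I})"
    using in_sum_of_minimal_ideals[of w] by simp
  then show thesis using that
    unfolding span_Un pseudo_abelian_summand_def nonpseudo_abelian_summand_def by blast
qed

lemma summands_star_closed:
  shows "x \<in> pseudo_abelian_summand F smul \<Longrightarrow> star x \<in> pseudo_abelian_summand F smul"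
    and "y \<in> nonpseudo_abelian_summand F smul \<Longrightarrow> star y \<in> nonpseudo_abelian_summand F smul"
  unfolding pseudo_abelian_summand_def nonpseudo_abelian_summand_def
  by (rule sum_of_minimal_ideals_closed(1); simp)+

lemma summands_smul_closed:
  assumes "c \<in> F"
  shows "x \<in> pseudo_abelian_summand F smul \<Longrightarrow> smul c x \<in> pseudo_abelian_summand F smul"
    and "y \<in> nonpseudo_abelian_summand F smul \<Longrightarrow> smul c y \<in> nonpseudo_abelian_summand F smul"
  using assms unfolding pseudo_abelian_summand_def nonpseudo_abelian_summand_def
  by (rule sum_of_minimal_ideals_closed(2)[rotated 2]; simp)+

lemma summands_product:
  assumes "x \<in> pseudo_abelian_summand F smul" "y \<in> nonpseudo_abelian_summand F smul"
  shows "x * y = 0" and "y * x = 0"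
  using assms unfolding pseudo_abelian_summand_def nonpseudo_abelian_summand_def
  by (intro sums_of_minimal_ideals_product; fastforce)+

lemma summands_bj_orthogonal:
  assumes x: "x \<in> pseudo_abelian_summand F smul" and y: "y \<in> nonpseudo_abelian_summand F smul"
  shows "bj_orthogonal F smul x y" and "bj_orthogonal F smul y x"
proof -
  have "norm (x + y) = max (norm x) (norm y)"
    if "x \<in> pseudo_abelian_summand F smul" "y \<in> nonpseudo_abelian_summand F smul" for x y
    using that summands_star_closed summands_product by (intro norm_add_orthogonal) blast+
  then show "bj_orthogonal F smul x y" "bj_orthogonal F smul y x"
    using x y summands_smul_closed by (simp_all add: bj_orthogonal_def add.commute)
      (metis add.commute max.cobounded2)
qed

text \<open>
  Subtracting a small multiple of \<open>u + u'\<close> from \<open>u \<noteq> 0\<close> shrinks the \<open>u\<close>-component and leaves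
  the \<open>u'\<close>-component small.
\<close>

lemma bj_orthogonal_to_extension:
  assumes "star u * u' = 0" "u * star u' = 0" "bj_orthogonal F smul u (u + u')"
  shows "u = 0"
proof (rule ccontr)
  assume "u \<noteq> 0"
  then have pos: "norm u > 0" by simp
  define t where "t = norm u / (2 * (norm u + norm u'))"
  have t: "0 < t" "t \<le> 1 / 2" "t * norm u' < norm u"
    using pos by (auto simp: t_def field_simps add_pos_nonneg add_nonneg_pos)
  have "norm u \<le> norm (u + smul (of_real (- t)) (u + u'))"
    using assms(3) of_real_in_scalars unfolding bj_orthogonal_def by blast
  also have "u + smul (of_real (- t)) (u + u') = (1 - t) *\<^sub>R u + (- t) *\<^sub>R u'"
    unfolding smul_of_real by (simp add: algebra_simps)
  also have "norm \<dots> = max (norm ((1 - t) *\<^sub>R u)) (norm ((- t) *\<^sub>R u'))"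
    using assms(1,2) by (intro norm_add_orthogonal) (simp_all add: star_scaleR star_minus)
  also have "\<dots> < norm u"
    using t pos by simp
  finally show False by simp
qed

section \<open>Elements of skew-field ideals are left-symmetric\<close>

lemma smul_0 [simp]: "c \<in> F \<Longrightarrow> smul c 0 = 0"
  using norm_smul[of c 0] by simp

lemma left_symmetricD:
  assumes "v \<in> left_symmetric_elements F smul" "bj_orthogonal F smul v w"
  shows "bj_orthogonal F smul w v"
  using assms by (auto simp: left_symmetric_elements_def right_perp_def left_perp_def)

text \<open>
  The unit \<open>e\<close> is self-adjoint because units are unique. A minimal projection on which it attains
  its norm lies in the ideal, and the only non-zero idempotent of a skew field is its unit.
\<close>

lemma skew_field_ideal_unit:
  assumes I: "minimal_ideal F smul I" and "skew_field_ideal I"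
  obtains e where "e \<in> I" "minimal_projection e" "\<And>x. x \<in> I \<Longrightarrow> e * x = x" "\<And>x. x \<in> I \<Longrightarrow> x * e = x"
proof -
  obtain e where e: "e \<in> I" "e \<noteq> 0" "\<And>x. x \<in> I \<Longrightarrow> e * x = x" "\<And>x. x \<in> I \<Longrightarrow> x * e = x"
    and inv: "\<And>x. x \<in> I \<Longrightarrow> x \<noteq> 0 \<Longrightarrow> \<exists>y\<in>I. x * y = e \<and> y * x = e"
    using assms(2) unfolding skew_field_ideal_def by blast
  have "e * star e = star e" using e minimal_ideal_star_closed[OF I] by blast
  then have sa: "star e = e" by (metis star_mult star_star)
  obtain p r where p: "minimal_projection p" "e * p = r *\<^sub>R p" "norm e \<le> \<bar>r\<bar>"
    using norm_attained_on_minimal_projection[OF sa e(2)] .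
  note pD = minimal_projectionD[OF p(1)]
  have ideal: "two_sided_ideal F smul I" using I by (simp add: minimal_ideal_def)
  have "r \<noteq> 0" using p(3) e(2) by auto
  moreover have "r *\<^sub>R p \<in> I" using e(1) ideal p(2) unfolding two_sided_ideal_def by metis
  then have "(1 / r) *\<^sub>R (r *\<^sub>R p) \<in> I" by (rule ideal_scaleR[OF ideal])
  ultimately have pI: "p \<in> I" by simp
  then obtain y where y: "p * y = e" using inv pD(3) by blast
  have "p * e = e" using pD(1) y by (metis mult.assoc)
  then have "p = e" using e(4)[OF pI] by simp
  then show thesis using that p(1) e by blast
qed

text \<open>
  A skew-field ideal \<open>I\<close> with unit \<open>e\<close> is an inner product space, since \<open>x\<^sup>*x = \<parallel>x\<parallel>\<^sup>2 e\<close>, so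
  orthogonality is symmetric there. Orthogonality of \<open>v \<in> I\<close> to \<open>w\<close> only depends on the component
  \<open>u = ew\<close>, and the component of \<open>w\<close> off \<open>I\<close> is unaffected by adding multiples of \<open>v\<close>.
\<close>

lemma skew_field_ideal_left_symmetric:
  assumes I: "minimal_ideal F smul I" "skew_field_ideal I" and v: "v \<in> I"
  shows "v \<in> left_symmetric_elements F smul"
proof -
  obtain e where e: "e \<in> I" "minimal_projection e" "\<And>x. x \<in> I \<Longrightarrow> e * x = x" "\<And>x. x \<in> I \<Longrightarrow> x * e = x"
    using skew_field_ideal_unit[OF I] by metis
  note eD = minimal_projectionD[OF e(2)]
  have ideal: "\<And>x y. x \<in> I \<Longrightarrow> y \<in> I \<Longrightarrow> x + y \<in> I" "\<And>c x. c \<in> F \<Longrightarrow> x \<in> I \<Longrightarrow> smul c x \<in> I"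
    "\<And>a x. x \<in> I \<Longrightarrow> a * x \<in> I" "\<And>a x. x \<in> I \<Longrightarrow> x * a \<in> I"
    using I(1) by (auto simp: minimal_ideal_def two_sided_ideal_def)
  have idealR: "\<And>r x. x \<in> I \<Longrightarrow> r *\<^sub>R x \<in> I"
    using I(1) ideal_scaleR by (auto simp: minimal_ideal_def)
  have starI: "\<And>x. x \<in> I \<Longrightarrow> star x \<in> I" using minimal_ideal_star_closed[OF I(1)] .
  have sq: "star x * x = (norm x)\<^sup>2 *\<^sub>R e" if "x \<in> I" for x
    using star_mult_self_minimal[OF e(2)] e(4)[OF that] by blast
  have expand: "(norm (x + y))\<^sup>2 *\<^sub>R e = ((norm x)\<^sup>2 + (norm y)\<^sup>2) *\<^sub>R e + (star x * y + star y * x)"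
    if "x \<in> I" "y \<in> I" for x y
    using sq[OF that(1)] sq[OF that(2)] sq[OF ideal(1)[OF that]]
    by (simp add: star_add algebra_simps)
  have cross_zero: "star x * z + star z * x = 0"
    if x: "x \<in> I" and z: "z \<in> I" and min: "\<And>t. norm x \<le> norm (x + t *\<^sub>R z)" for x z
  proof -
    let ?k = "star x * z + star z * x"
    have k: "star ?k = ?k" by (simp add: star_add star_mult star_star add.commute)
    have kI: "?k \<in> I" by (intro ideal(1,3) x z)
    obtain b where b: "?k = b *\<^sub>R e"
      using minimal_projection_scalar[OF e(2) k e(3)[OF kI] e(4)[OF kI]] by blast
    have quadratic: "0 \<le> t * b + t\<^sup>2 * (norm z)\<^sup>2" for t
    proof -
      have "star x * (t *\<^sub>R z) + star (t *\<^sub>R z) * x = t *\<^sub>R ?k"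
        by (simp add: star_scaleR scaleR_add_right)
      then have "(norm (x + t *\<^sub>R z))\<^sup>2 *\<^sub>R e = ((norm x)\<^sup>2 + t\<^sup>2 * (norm z)\<^sup>2 + t * b) *\<^sub>R e"
        using expand[OF x idealR[OF z], of t] b
        by (simp add: power_mult_distrib scaleR_add_left)
      then have "(norm (x + t *\<^sub>R z))\<^sup>2 = (norm x)\<^sup>2 + t\<^sup>2 * (norm z)\<^sup>2 + t * b"
        using eD(3) by simp
      moreover have "(norm x)\<^sup>2 \<le> (norm (x + t *\<^sub>R z))\<^sup>2" using min by (intro power_mono) auto
      ultimately show ?thesis by linarith
    qed
    have "b = 0"
    proof (rule ccontr)
      assume "b \<noteq> 0"
      \<comment> \<open>a step in the direction of \<open>-b\<close>, short enough for the linear term to dominate\<close>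
      define s where "s = 1 / ((norm z)\<^sup>2 + 1)"
      have s: "s > 0" "s * (norm z)\<^sup>2 < 1"
        by (auto simp: s_def field_simps add_pos_nonneg add_nonneg_pos)
      have "0 \<le> b\<^sup>2 * s * (s * (norm z)\<^sup>2 - 1)"
        using quadratic[of "- (s * b)"] by (simp add: algebra_simps power2_eq_square)
      moreover have "b\<^sup>2 * s > 0" using \<open>b \<noteq> 0\<close> s by simp
      ultimately show False using s(2) by (simp add: zero_le_mult_iff)
    qed
    then show ?thesis using b by simp
  qed
  have "bj_orthogonal F smul w v" if vw: "bj_orthogonal F smul v w" for w
  proof -
    define u where "u = e * w"
    define w' where "w' = w - u"
    have uI: "u \<in> I" unfolding u_def by (rule ideal(4)[OF e(1)])
    have "w * e = e * w"
      using e(3)[OF ideal(3)[OF e(1), of w]] e(4)[OF ideal(4)[OF e(1), of w]] by (simp add: mult.assoc)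
    then have w'e: "w' * e = 0" "e * w' = 0"
      using eD(1) by (simp_all add: w'_def u_def left_diff_distrib right_diff_distrib mult.assoc
          flip: mult.assoc[of e e])
    have w: "w = u + w'" by (simp add: w'_def)
    have split: "norm (x + smul c w') = max (norm x) (norm (smul c w'))"
      if x: "x \<in> I" and c: "c \<in> F" for x c
    proof (rule norm_add_orthogonal)
      have "star x * w' = 0" using e(4)[OF starI[OF x]] w'e by (metis mult.assoc mult_zero_right)
      then show "star x * smul c w' = 0"
        using c by (simp add: smul_mult_right)
      have "e * star w' = 0" using w'e(1) eD(2) star_mult star_0 by metis
      then have "x * star w' = 0" using e(4)[OF x] by (metis mult.assoc mult_zero_right)
      then show "x * star (smul c w') = 0"
        using c cnj_in_scalars[OF c] by (simp add: star_smul smul_mult_right)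
    qed
    have vu: "norm v \<le> norm (v + smul c u)" if c: "c \<in> F" for c
    proof (rule ccontr)
      assume less: "\<not> norm v \<le> norm (v + smul c u)"
      then have pos: "norm v > 0" by (metis norm_ge_zero not_le order_le_less_trans)
      let ?k = "norm (smul c w')"
      define t where "t = norm v / (2 * (norm v + ?k))"
      have t: "0 < t" "t \<le> 1 / 2" "t * ?k < norm v"
        using pos by (auto simp: t_def field_simps add_pos_nonneg add_nonneg_pos)
      have tc: "of_real t * c \<in> F" "smul (of_real t * c) z = t *\<^sub>R smul c z" for z
        using c scalars by (auto simp: smul_of_real simp flip: smul_smul)
      have "v + smul (of_real t * c) w = (v + t *\<^sub>R smul c u) + smul (of_real t * c) w'"
        unfolding w using tc c by (simp add: smul_add_right scaleR_add_right)
      moreover have "v + t *\<^sub>R smul c u \<in> I" by (intro ideal(1,2) idealR v uI c)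
      ultimately have "norm (v + smul (of_real t * c) w) = max (norm (v + t *\<^sub>R smul c u)) (t * ?k)"
        using split[of "v + t *\<^sub>R smul c u" "of_real t * c"] tc t by (simp add: add.assoc)
      moreover have "norm (v + t *\<^sub>R smul c u) < norm v"
      proof -
        have "v + t *\<^sub>R smul c u = (1 - t) *\<^sub>R v + t *\<^sub>R (v + smul c u)" by (simp add: algebra_simps)
        then have "norm (v + t *\<^sub>R smul c u) \<le> (1 - t) * norm v + t * norm (v + smul c u)"
          using norm_triangle_ineq[of "(1 - t) *\<^sub>R v" "t *\<^sub>R (v + smul c u)"] t by simp
        also have "\<dots> < (1 - t) * norm v + t * norm v" using less t by simp
        finally show ?thesis by (simp add: algebra_simps)
      qed
      moreover have "norm v \<le> norm (v + smul (of_real t * c) w)"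
        using vw tc(1) unfolding bj_orthogonal_def by blast
      ultimately show False using t by simp
    qed
    have cross: "star u * smul c v + star (smul c v) * u = 0" if c: "c \<in> F" for c
    proof -
      have z: "smul (cnj c) u \<in> I" by (rule ideal(2)[OF cnj_in_scalars[OF c] uI])
      have "norm v \<le> norm (v + t *\<^sub>R smul (cnj c) u)" for t
      proof -
        have "of_real t * cnj c \<in> F" using cnj_in_scalars[OF c] scalars by auto
        then show ?thesis using vu[of "of_real t * cnj c"] c
          by (simp add: cnj_in_scalars smul_of_real flip: smul_smul)
      qed
      from cross_zero[OF v z this] show ?thesis
        using c by (simp add: star_smul cnj_in_scalars smul_mult_left smul_mult_right add.commute)
    qed
    have "norm w \<le> norm (w + smul c v)" if c: "c \<in> F" for c
    proof -
      have "(norm (u + smul c v))\<^sup>2 *\<^sub>R e = ((norm u)\<^sup>2 + (norm (smul c v))\<^sup>2) *\<^sub>R e"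
        using expand[OF uI ideal(2)[OF c v]] cross[OF c] by simp
      then have "(norm u)\<^sup>2 \<le> (norm (u + smul c v))\<^sup>2" using eD(3) by simp
      then have "norm u \<le> norm (u + smul c v)" by (rule power2_le_imp_le) simp
      moreover have "norm w = max (norm u) (norm w')" using split[OF uI one_in_scalars] w by simp
      moreover have "w + smul c v = (u + smul c v) + smul 1 w'" using w by simp
      then have "norm (w + smul c v) = max (norm (u + smul c v)) (norm w')"
        using split[OF ideal(1)[OF uI ideal(2)[OF c v]] one_in_scalars] by (metis smul_1)
      ultimately show ?thesis by simp
    qed
    then show ?thesis by (simp add: bj_orthogonal_def)
  qed
  then show ?thesis by (auto simp: left_symmetric_elements_def right_perp_def left_perp_def)
qed

section \<open>Left-symmetric elements lie in skew-field ideals\<close>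

lemma bj_orthogonal_scaleR_left:
  assumes "bj_orthogonal F smul v w"
  shows "bj_orthogonal F smul (r *\<^sub>R v) w"
proof (cases "r = 0")
  case False
  have "norm (r *\<^sub>R v) \<le> norm (r *\<^sub>R v + smul c w)" if c: "c \<in> F" for c
  proof -
    have cr: "of_real (1 / r) * c \<in> F" using c scalars by (auto simp del: of_real_divide)
    have "smul (of_real (1 / r) * c) w = (1 / r) *\<^sub>R smul c w"
      using c by (simp add: smul_of_real del: of_real_divide flip: smul_smul)
    then have "r *\<^sub>R v + smul c w = r *\<^sub>R (v + smul (of_real (1 / r) * c) w)"
      using False by (simp add: scaleR_add_right)
    moreover have "norm v \<le> norm (v + smul (of_real (1 / r) * c) w)"
      using assms cr unfolding bj_orthogonal_def by blast
    ultimately show ?thesis by (simp add: mult_left_mono)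
  qed
  then show ?thesis by (simp add: bj_orthogonal_def)
qed (simp add: bj_orthogonal_def)

lemma bj_orthogonal_scaleR_right:
  assumes "bj_orthogonal F smul w v"
  shows "bj_orthogonal F smul w (r *\<^sub>R v)"
  unfolding bj_orthogonal_def
proof
  fix c assume c: "c \<in> F"
  then have "smul c (r *\<^sub>R v) = smul (c * of_real r) v"
    by (metis of_real_in_scalars smul_of_real smul_smul)
  moreover have "c * of_real r \<in> F" using c scalars by auto
  ultimately show "norm w \<le> norm (w + smul c (r *\<^sub>R v))"
    using assms by (simp add: bj_orthogonal_def)
qed

lemma left_symmetric_scaleR:
  assumes v: "v \<in> left_symmetric_elements F smul" and "r \<noteq> 0"
  shows "r *\<^sub>R v \<in> left_symmetric_elements F smul"
proof -
  have "bj_orthogonal F smul w (r *\<^sub>R v)" if "bj_orthogonal F smul (r *\<^sub>R v) w" for w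
  proof -
    have "bj_orthogonal F smul v w"
      using bj_orthogonal_scaleR_left[OF that, of "1 / r"] assms(2) by simp
    then show ?thesis using left_symmetricD[OF v] bj_orthogonal_scaleR_right by blast
  qed
  then show ?thesis by (auto simp: left_symmetric_elements_def right_perp_def left_perp_def)
qed

text \<open>
  If \<open>v\<close> attains its norm on \<open>p\<close>, vanishing of the cross term there suffices for orthogonality,
  by the Pythagorean identity for \<open>(v + cw)p\<close>.
\<close>

lemma bj_orthogonal_if_cross_term_zero:
  assumes p: "minimal_projection p" and v: "norm v = 1" "star v * v * p = p"
    and cross: "p * star v * w * p = 0"
  shows "bj_orthogonal F smul v w"
  unfolding bj_orthogonal_def
proof
  fix c assume c: "c \<in> F"
  note pD = minimal_projectionD[OF p]
  let ?z = "smul c w * p" and ?y = "(v + smul c w) * p"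
  have "star (v * p) * (v * p) = p" using v(2) pD by (simp add: star_mult mult.assoc)
  moreover have cr: "star (v * p) * ?z = 0"
    using cross c pD by (simp add: star_mult smul_mult_left smul_mult_right mult.assoc)
  moreover have "star ?z * (v * p) = 0" using cr by (metis star_0 star_mult star_star)
  moreover have "star ?z * ?z = (norm ?z)\<^sup>2 *\<^sub>R p"
    by (rule star_mult_self_minimal[OF p]) (simp add: mult.assoc pD)
  ultimately have "star ?y * ?y = (1 + (norm ?z)\<^sup>2) *\<^sub>R p"
    by (simp add: star_add scaleR_add_left distrib_left distrib_right)
  moreover have "star ?y * ?y = (norm ?y)\<^sup>2 *\<^sub>R p"
    by (rule star_mult_self_minimal[OF p]) (simp add: mult.assoc pD)
  ultimately have "(norm ?y)\<^sup>2 = 1 + (norm ?z)\<^sup>2" using pD(3) by (metis scaleR_cancel_right)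
  then have "1\<^sup>2 \<le> (norm ?y)\<^sup>2" by simp
  then have "1 \<le> norm ?y" by (rule power2_le_imp_le) simp
  also have "\<dots> \<le> norm (v + smul c w)"
    using norm_mult_ineq[of "v + smul c w" p] pD(4) by simp
  finally show "norm v \<le> norm (v + smul c w)" using v(1) by simp
qed

text \<open>
  Let \<open>v\<close> attain its norm on \<open>p\<close>. It is orthogonal to its own part \<open>w = v - vp\<close>; by
  left-symmetry \<open>w\<close> is orthogonal to \<open>v = w + vp\<close>, so \<open>w = 0\<close>.
\<close>

lemma left_symmetric_partial_isometry:
  assumes v: "v \<in> left_symmetric_elements F smul" "norm v = 1"
  obtains p where "minimal_projection p" "v * p = v" "star v * v = p"
proof -
  let ?h = "star v * v"
  have h: "star ?h = ?h" "norm ?h = 1" "?h \<noteq> 0"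
    using v(2) by (auto simp: star_mult star_star cstar_identity star_mult_self_eq_0)
  obtain p r where p: "minimal_projection p" "?h * p = r *\<^sub>R p" "norm ?h \<le> \<bar>r\<bar>"
    using norm_attained_on_minimal_projection[OF h(1,3)] .
  note pD = minimal_projectionD[OF p(1)]
  have "star (v * p) * (v * p) = p * (?h * p)" using pD by (simp add: star_mult mult.assoc)
  also have "\<dots> = r *\<^sub>R p" using p(2) pD by simp
  also have "star (v * p) * (v * p) = (norm (v * p))\<^sup>2 *\<^sub>R p"
    by (rule star_mult_self_minimal[OF p(1)]) (simp add: mult.assoc pD)
  finally have r: "r = (norm (v * p))\<^sup>2" using pD(3) by simp
  have "norm (v * p) \<le> 1" using norm_mult_ineq[of v p] v(2) pD(4) by simp
  then have "r \<le> 1" unfolding r by (simp add: power_le_one)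
  moreover have "1 \<le> \<bar>r\<bar>" using p(3) h(2) by simp
  moreover have "0 \<le> r" unfolding r by simp
  ultimately have hp: "?h * p = p" using p(2) by simp
  then have ph: "p * ?h = p" using h(1) pD(2) star_mult by metis
  define w where "w = v - v * p"
  have wp: "w * p = 0" by (simp add: w_def left_diff_distrib mult.assoc pD)
  have "p * star v * w * p = 0" using wp by (simp add: mult.assoc)
  then have "bj_orthogonal F smul v w" using bj_orthogonal_if_cross_term_zero[OF p(1) v(2) hp] by blast
  then have "bj_orthogonal F smul w (w + v * p)"
    using left_symmetricD[OF v(1)] by (simp add: w_def)
  moreover have "star w * (v * p) = ?h * p - p * (?h * p)"
    using pD by (simp add: w_def star_diff star_mult left_diff_distrib mult.assoc)
  then have "star w * (v * p) = 0" using hp pD by simp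
  moreover have "w * star (v * p) = w * p * star v" using pD by (simp add: star_mult mult.assoc)
  then have "w * star (v * p) = 0" using wp by simp
  ultimately have "w = 0" by (rule bj_orthogonal_to_extension[rotated 2])
  then have vp: "v * p = v" by (simp add: w_def)
  then have "?h = p" using hp by (simp add: mult.assoc)
  then show thesis using that p(1) vp by blast
qed

text \<open>
  If \<open>pA = pAp\<close>, then by taking adjoints \<open>p\<close> is central, so \<open>pA\<close> is an ideal, and \<open>x\<^sup>*\<close> is up to a
  real factor inverse to \<open>x\<close> there.
\<close>

lemma central_minimal_projection_ideal:
  assumes p: "minimal_projection p" and central: "\<And>a. p * a = p * a * p"
  shows "minimal_ideal F smul {x. p * x = x}" and "skew_field_ideal {x. p * x = x}"
proof -
  note pD = minimal_projectionD[OF p]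
  let ?I = "{x. p * x = x}"
  have "a * p = p * a * p" for a
    using arg_cong[OF central[of "star a"], of star] pD(2) by (simp add: star_mult star_star mult.assoc)
  then have comm: "p * a = a * p" for a using central by metis
  have ideal: "two_sided_ideal F smul ?I"
    unfolding two_sided_ideal_def
  proof (intro conjI ballI allI)
    show "a * x \<in> ?I" if "x \<in> ?I" for a x
      using that comm[of a] by (simp flip: mult.assoc) (metis comm mult.assoc mem_Collect_eq that)
  qed (auto simp: distrib_left smul_mult_right simp flip: mult.assoc)
  have sq: "star x * x = (norm x)\<^sup>2 *\<^sub>R p" "x * star x = (norm x)\<^sup>2 *\<^sub>R p" "star x \<in> ?I"
    if "x \<in> ?I" for x
  proof -
    have px: "p * x = x" "x * p = x" using that comm[of x] by simp_all
    then have sx: "p * star x = star x" "star x * p = star x" using pD(2) star_mult by metis+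
    show "star x * x = (norm x)\<^sup>2 *\<^sub>R p" using star_mult_self_minimal[OF p px(2)] .
    show "x * star x = (norm x)\<^sup>2 *\<^sub>R p"
      using star_mult_self_minimal[OF p sx(2)] by (simp add: star_star norm_star)
    show "star x \<in> ?I" using sx by simp
  qed
  have inverse: "\<exists>y\<in>?I. x * y = p \<and> y * x = p" if x: "x \<in> ?I" "x \<noteq> 0" for x
  proof (intro bexI conjI)
    let ?y = "(1 / (norm x)\<^sup>2) *\<^sub>R star x"
    show "x * ?y = p" "?y * x = p" using sq[OF x(1)] x(2) by simp_all
    show "?y \<in> ?I" by (rule ideal_scaleR[OF ideal sq(3)[OF x(1)]])
  qed
  show "skew_field_ideal ?I"
    unfolding skew_field_ideal_def
  proof (rule bexI[of _ p])
    have "p * x = x \<and> x * p = x" if "x \<in> ?I" for x using that comm[of x] by simp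
    then show "p \<noteq> 0 \<and> (\<forall>x\<in>?I. p * x = x \<and> x * p = x) \<and>
        (\<forall>x\<in>?I. x \<noteq> 0 \<longrightarrow> (\<exists>y\<in>?I. x * y = p \<and> y * x = p))"
      using pD(3) inverse by blast
  qed (simp add: pD(1))
  show "minimal_ideal F smul ?I"
    unfolding minimal_ideal_def
  proof (intro conjI allI impI)
    show "?I \<noteq> {0}" using pD by blast
    fix J assume J: "two_sided_ideal F smul J" "J \<subseteq> ?I"
    show "J = {0} \<or> J = ?I"
    proof (rule disjCI)
      assume "J \<noteq> ?I"
      moreover have "?I \<subseteq> J" if x: "x \<in> J" "x \<noteq> 0" for x
      proof -
        obtain y where "x * y = p" using inverse x J(2) by blast
        then have "p \<in> J" using J(1) x(1) unfolding two_sided_ideal_def by metis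
        then have pJ: "p * z \<in> J" for z using J(1) by (simp add: two_sided_ideal_def)
        show ?thesis
        proof
          fix z assume "z \<in> ?I"
          then show "z \<in> J" using pJ[of z] by simp
        qed
      qed
      moreover have "0 \<in> J" using J(1) by (simp add: two_sided_ideal_def)
      ultimately show "J = {0}" using J(2) by blast
    qed
  qed (rule ideal)
qed

text \<open>
  Read \<open>v\<close>, \<open>vs\<close>, \<open>tv\<close>, \<open>tvs\<close> as the matrix units \<open>E\<^sub>1\<^sub>1\<close>, \<open>E\<^sub>1\<^sub>2\<close>, \<open>E\<^sub>2\<^sub>1\<close>, \<open>E\<^sub>2\<^sub>2\<close> of the real \<open>2 \<times> 2\<close>
  matrices, with \<open>x\<^sup>*y\<close> corresponding to the product of the transpose of \<open>x\<close> with \<open>y\<close>. The matrix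
  \<open>w\<close> with rows \<open>(0, 2)\<close> and \<open>(2, 3)\<close> has eigenvalues \<open>4\<close> and \<open>-1\<close>, so its norm is at least \<open>4\<close>. It has a zero where \<open>v\<close> has its only entry, so \<open>v\<close> is orthogonal to \<open>w\<close>. But
  \<open>w - 3v\<close> has rows \<open>(-3, 2)\<close> and \<open>(2, 3)\<close>, which is \<open>\<surd>13\<close> times an orthogonal matrix.
\<close>

lemma matrix_unit_not_left_symmetric:
  assumes p: "minimal_projection p" and q: "minimal_projection q"
    and v: "norm v = 1" "v * p = v" "q * v = v" "star v * v = p"
    and s: "p * s = s" "s * p = 0" "s * star s = p"
    and t: "t * q = t" "q * t = 0" "star t * t = q"
  shows "v \<notin> left_symmetric_elements F smul"
proof
  assume L: "v \<in> left_symmetric_elements F smul"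
  note pD = minimal_projectionD[OF p]
  note qD = minimal_projectionD[OF q]
  define w where "w = 2 *\<^sub>R (v * s) + 2 *\<^sub>R (t * v) + 3 *\<^sub>R (t * v * s)"
  have sp: "star s * p = star s" "p * star s = 0" using s pD(2) star_mult star_0 by metis+
  have vp: "p * star v = star v" "star v * q = star v" using v pD(2) qD(2) star_mult by metis+
  have tq: "star t * q = 0" using t qD(2) star_mult star_0 by metis
  have vt: "star v * t = 0" using vp(2) t(2) by (metis mult.assoc mult_zero_right)
  have tv: "star t * v = 0" using tq v(3) by (metis mult.assoc mult_zero_left)
  have ss: "s * s = 0" using s by (metis mult.assoc mult_zero_left)
  have rules: "star v * (v * z) = p * z" "star v * (t * z) = 0" "star t * (v * z) = 0"
    "star t * (t * z) = q * z" "q * (v * z) = v * z" "p * (s * z) = s * z" "s * (star s * z) = p * z"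
    "s * (s * z) = 0" "s * (p * z) = 0" "star s * (p * z) = star s * z" "p * (star s * z) = 0"
    "p * (p * z) = p * z" for z
    using v(4) vt tv t(3) v(3) s ss sp pD(1) by (simp_all flip: mult.assoc)
  note simps = rules v(3,4) vt tv t(3) s sp ss vp pD(1)
  have star_w: "star w = 2 *\<^sub>R (star s * star v) + 2 *\<^sub>R (star v * star t)
      + 3 *\<^sub>R (star s * (star v * star t))"
    by (simp add: w_def star_add star_scaleR star_mult mult.assoc)
  have split: "13 *\<^sub>R z = 4 *\<^sub>R z + 9 *\<^sub>R z" "16 *\<^sub>R z = 4 *\<^sub>R z + 12 *\<^sub>R z"
    "32 *\<^sub>R z = 6 *\<^sub>R z + 26 *\<^sub>R z" for z :: 'a by (simp_all flip: scaleR_add_left)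
  have ww: "star w * w = 4 *\<^sub>R p + 6 *\<^sub>R s + 6 *\<^sub>R star s + 13 *\<^sub>R (star s * s)"
    unfolding star_w unfolding w_def
    by (simp add: distrib_left distrib_right mult.assoc simps scaleR_add_right split(1) add_ac)
  have vw: "star v * w = 2 *\<^sub>R s" unfolding w_def
    by (simp add: distrib_left mult.assoc simps)
  have wv: "star w * v = 2 *\<^sub>R star s" unfolding star_w
    by (simp add: distrib_right mult.assoc simps)
  have "p * star v * w * p = 0" using vw s(2) vp(1) by simp
  moreover have "star v * v * p = p" by (simp add: simps)
  ultimately have "bj_orthogonal F smul v w"
    using bj_orthogonal_if_cross_term_zero[OF p v(1)] by blast
  then have "bj_orthogonal F smul w v" by (rule left_symmetricD[OF L])
  then have "norm w \<le> norm (w + smul (of_real (- 3)) v)"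
    unfolding bj_orthogonal_def using of_real_in_scalars by blast
  then have le: "norm w \<le> norm (w - 3 *\<^sub>R v)" unfolding smul_of_real by simp
  \<comment> \<open>The symmetric matrix \<open>w\<close> has the eigenvector \<open>(1, 2)\<close> for the eigenvalue \<open>4\<close>, so \<open>w\<^sup>*w\<close> has
    it for \<open>16\<close>; \<open>k\<close> is that vector as a first row.\<close>
  define k where "k = p + 2 *\<^sub>R s"
  have "k * (star w * w) = 16 *\<^sub>R k"
    unfolding ww k_def
    by (simp add: distrib_left distrib_right mult.assoc simps scaleR_add_right split(2,3) add_ac)
  then have "16 * norm k \<le> norm k * (norm w)\<^sup>2"
    using norm_mult_ineq[of k "star w * w"] by (simp add: cstar_identity)
  moreover have "k * p = p" by (simp add: k_def distrib_right simps)
  then have "norm k > 0" using pD(3) by auto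
  ultimately have ge: "16 \<le> (norm w)\<^sup>2" by (simp add: mult.commute)
  have "star (w - 3 *\<^sub>R v) * (w - 3 *\<^sub>R v)
      = star w * w - 3 *\<^sub>R (star w * v) - 3 *\<^sub>R (star v * w) + 9 *\<^sub>R (star v * v)"
    by (simp add: star_diff star_scaleR left_diff_distrib right_diff_distrib scaleR_diff_right)
  also have "\<dots> = 13 *\<^sub>R (p + star s * s)"
    unfolding ww vw wv v(4) by (simp add: scaleR_add_right flip: scaleR_add_left)
  finally have "(norm (w - 3 *\<^sub>R v))\<^sup>2 = 13 * norm (p + star s * s)"
    by (simp flip: cstar_identity)
  moreover have "projection (p + star s * s)"
    using pD(2) by (simp add: projection_def star_add star_mult star_star distrib_left distrib_right
        mult.assoc simps)
  moreover have "(p + star s * s) * p = p" by (simp add: distrib_right mult.assoc simps)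
  then have "p + star s * s \<noteq> 0" using pD(3) by auto
  ultimately have "(norm (w - 3 *\<^sub>R v))\<^sup>2 = 13" by (simp add: norm_projection)
  moreover have "(norm w)\<^sup>2 \<le> (norm (w - 3 *\<^sub>R v))\<^sup>2" using le by (intro power_mono) auto
  ultimately show False using ge by simp
qed

text \<open>
  After normalisation \<open>v\<close> is a partial isometry with \<open>p = v\<^sup>*v\<close> and \<open>q = vv\<^sup>*\<close>. If neither of them is
  central, elements \<open>s\<close> of \<open>pA\<close> and \<open>t\<close> of \<open>Aq\<close> off the diagonal complete \<open>v\<close> to a system of matrix
  units. If \<open>q\<close> is central, then \<open>p\<close> lies in \<open>qAq\<close> and is a real multiple of \<open>q\<close>, so \<open>p = q\<close>.
\<close>

lemma left_symmetric_in_pseudo_abelian: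
  assumes v: "v \<in> left_symmetric_elements F smul"
  shows "v \<in> pseudo_abelian_summand F smul"
proof -
  have unit: "u \<in> pseudo_abelian_summand F smul"
    if u: "u \<in> left_symmetric_elements F smul" "norm u = 1" for u
  proof -
    obtain p where p: "minimal_projection p" and up: "u * p = u" and uu: "star u * u = p"
      using left_symmetric_partial_isometry[OF u] .
    note pD = minimal_projectionD[OF p]
    define q where "q = u * star u"
    have qu: "q * u = u" by (simp add: q_def mult.assoc uu up)
    have us: "star u * q = star u" by (metis q_def qu star_mult star_star)
    have q: "minimal_projection q"
      unfolding minimal_projection_def
    proof (intro conjI allI impI)
      show "projection q"
        using qu by (simp add: projection_def q_def star_mult star_star flip: mult.assoc)
      show "q \<noteq> 0" using qu u(2) by auto
      fix x assume x: "star x = x" "q * x = x" "x * q = x"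
      have "star u * x * u * p = star u * x * u" using up by (simp add: mult.assoc)
      moreover have "p * (star u * x * u) = star u * x * u"
        using pD(2) up star_mult by (metis mult.assoc)
      moreover have "star (star u * x * u) = star u * x * u"
        using x(1) by (simp add: star_mult star_star mult.assoc)
      ultimately obtain r where r: "star u * x * u = r *\<^sub>R p"
        using minimal_projection_scalar[OF p] by metis
      have "x = q * x * q" using x by simp
      also have "\<dots> = u * (star u * x * u) * star u" by (simp add: q_def mult.assoc)
      also have "\<dots> = r *\<^sub>R q" using r up by (simp add: q_def)
      finally show "\<exists>r. x = r *\<^sub>R q" by blast
    qed
    note qD = minimal_projectionD[OF q]
    show ?thesis
    proof (cases "\<forall>a. p * a = p * a * p")
      case True
      then have central: "\<And>a. p * a = p * a * p" by blast
      have "star (p * star u) = star (p * star u * p)" using True by metis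
      then have "p * u = u" using pD(2) up by (simp add: star_mult star_star)
      then show ?thesis
        using central_minimal_projection_ideal[OF p central]
        unfolding pseudo_abelian_summand_def by (intro span_base) blast
    next
      case False
      then obtain a where a: "p * a \<noteq> p * a * p" by blast
      have "\<exists>b. b * q \<noteq> q * b * q"
      proof (rule ccontr)
        assume "\<not> (\<exists>b. b * q \<noteq> q * b * q)"
        then have qb: "b * q = q * b * q" for b by blast
        have qb': "q * b = q * b * q" for b
          using arg_cong[OF qb[of "star b"], of star]
          by (simp add: star_mult star_star qD(1,2) mult.assoc)
        have "q * p = q * star u * u" by (simp add: mult.assoc uu)
        also have "\<dots> = star u * q * u" using qb qb' by metis
        also have "\<dots> = p" using us uu by simp
        finally have qp: "q * p = p" .
        then have pq: "p * q = p" using pD(2) qD(2) star_mult by metis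
        obtain r where r: "p = r *\<^sub>R q" using minimal_projection_scalar[OF q pD(2) qp pq] .
        have "r \<noteq> 0" using r pD(3) by auto
        moreover have "r *\<^sub>R p = p" using pq pD(1) r by (metis mult_scaleR_right)
        ultimately have "p = q" using r pD(3) by auto
        then show False using a qb'[of a] by simp
      qed
      then obtain b where b: "b * q \<noteq> q * b * q" by blast
      define s where "s = (1 / norm (p * a - p * a * p)) *\<^sub>R (p * a - p * a * p)"
      define t where "t = (1 / norm (b * q - q * b * q)) *\<^sub>R (b * q - q * b * q)"
      have normalised: "norm s = 1" "norm t = 1" using a b by (simp_all add: s_def t_def)
      have s: "p * s = s" "s * p = 0"
        using pD(1) by (simp_all add: s_def left_diff_distrib right_diff_distrib mult.assoc flip: mult.assoc[of p p])
      have t: "t * q = t" "q * t = 0"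
        using qD(1) by (simp_all add: t_def left_diff_distrib right_diff_distrib mult.assoc flip: mult.assoc[of q q])
      have "star s * p = star s" using s pD(2) star_mult by metis
      then have "s * star s = p"
        using star_mult_self_minimal[OF p, of "star s"] normalised by (simp add: star_star norm_star)
      moreover have "star t * t = q" using star_mult_self_minimal[OF q t(1)] normalised by simp
      ultimately have "u \<notin> left_symmetric_elements F smul"
        using matrix_unit_not_left_symmetric[OF p q u(2) up qu uu s _ t] by blast
      then show ?thesis using u(1) by blast
    qed
  qed
  show ?thesis
  proof (cases "v = 0")
    case False
    have "(1 / norm v) *\<^sub>R v \<in> left_symmetric_elements F smul"
      using left_symmetric_scaleR[OF v] False by simp
    then have "(1 / norm v) *\<^sub>R v \<in> pseudo_abelian_summand F smul" using unit False by simp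
    then have "norm v *\<^sub>R ((1 / norm v) *\<^sub>R v) \<in> pseudo_abelian_summand F smul"
      unfolding pseudo_abelian_summand_def by (rule span_scale)
    then show ?thesis using False by simp
  qed (simp add: pseudo_abelian_summand_def span_zero)
qed

section \<open>The orthogonal complements\<close>

text \<open>
  If \<open>w\<close> is orthogonal to all left-symmetric elements, then its component \<open>ew\<close> in a skew-field
  ideal with unit \<open>e\<close> is among them, hence orthogonal to \<open>w\<close> and therefore zero.
\<close>

lemma set_perp_left_symmetric:
  "set_perp F smul (left_symmetric_elements F smul) = nonpseudo_abelian_summand F smul"
proof (intro equalityI subsetI)
  fix w assume "w \<in> nonpseudo_abelian_summand F smul"
  then show "w \<in> set_perp F smul (left_symmetric_elements F smul)"
    using left_symmetric_in_pseudo_abelian summands_bj_orthogonal(1)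
    by (auto simp: set_perp_def right_perp_def)
next
  fix w assume w: "w \<in> set_perp F smul (left_symmetric_elements F smul)"
  obtain x y where x: "x \<in> pseudo_abelian_summand F smul"
    and y: "y \<in> nonpseudo_abelian_summand F smul" and wxy: "w = x + y"
    using pseudo_abelian_decomposition .
  have kill: "z * x = 0" if I: "minimal_ideal F smul I" "skew_field_ideal I" and z: "z \<in> I" for I z
  proof -
    obtain e where e: "e \<in> I" "minimal_projection e" "\<And>x. x \<in> I \<Longrightarrow> e * x = x" "\<And>x. x \<in> I \<Longrightarrow> x * e = x"
      using skew_field_ideal_unit[OF I] by metis
    note eD = minimal_projectionD[OF e(2)]
    have eP: "e \<in> pseudo_abelian_summand F smul"
      unfolding pseudo_abelian_summand_def using I e(1) by (intro span_base) blast
    define u where "u = e * w"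
    have uI: "u \<in> I" using I(1) e(1) by (simp add: u_def minimal_ideal_def two_sided_ideal_def)
    have "w * e \<in> I" using I(1) e(1) by (simp add: minimal_ideal_def two_sided_ideal_def)
    then have we: "w * e = u" using e(3)[of "w * e"] e(4)[OF uI] by (simp add: u_def mult.assoc)
    have "bj_orthogonal F smul u w"
      using w skew_field_ideal_left_symmetric[OF I uI] by (auto simp: set_perp_def right_perp_def)
    then have bj: "bj_orthogonal F smul u (u + (w - u))" by simp
    have off: "e * (w - u) = 0" "(w - u) * e = 0"
      using e(3)[OF uI] e(4)[OF uI] by (simp_all add: left_diff_distrib right_diff_distrib we) (simp add: u_def)
    have "star u * e = star u" using e(4) minimal_ideal_star_closed[OF I(1) uI] by blast
    then have "star u * (w - u) = 0" using off(1) by (metis mult.assoc mult_zero_right)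
    moreover have "e * star (w - u) = 0" using off(2) eD(2) star_mult star_0 by metis
    then have "u * star (w - u) = 0" using e(4)[OF uI] by (metis mult.assoc mult_zero_right)
    ultimately have "u = 0" using bj by (rule bj_orthogonal_to_extension)
    then have "e * x = 0" using summands_product(1)[OF eP y] by (simp add: u_def wxy distrib_left)
    then show ?thesis using e(4)[OF z] by (metis mult.assoc mult_zero_right)
  qed
  have "star x \<in> {z. z * x = 0}"
  proof (rule span_minimal[THEN subsetD])
    show "star x \<in> span (\<Union>{I. minimal_ideal F smul I \<and> skew_field_ideal I})"
      using summands_star_closed(1)[OF x] by (simp add: pseudo_abelian_summand_def)
    show "\<Union>{I. minimal_ideal F smul I \<and> skew_field_ideal I} \<subseteq> {z. z * x = 0}" using kill by blast
    show "subspace {z. z * x = 0}" by (auto simp: subspace_def distrib_right)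
  qed
  then have "x = 0" by (simp add: star_mult_self_eq_0)
  then show "w \<in> nonpseudo_abelian_summand F smul" using wxy y by simp
qed

lemma set_perp_nonpseudo_abelian:
  "set_perp F smul (nonpseudo_abelian_summand F smul) = pseudo_abelian_summand F smul"
proof (intro equalityI subsetI)
  fix w assume "w \<in> pseudo_abelian_summand F smul"
  then show "w \<in> set_perp F smul (nonpseudo_abelian_summand F smul)"
    using summands_bj_orthogonal(2) by (auto simp: set_perp_def right_perp_def)
next
  fix w assume w: "w \<in> set_perp F smul (nonpseudo_abelian_summand F smul)"
  obtain x y where x: "x \<in> pseudo_abelian_summand F smul"
    and y: "y \<in> nonpseudo_abelian_summand F smul" and wxy: "w = x + y"
    using pseudo_abelian_decomposition .
  have "bj_orthogonal F smul y (y + x)"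
    using w y by (auto simp: set_perp_def right_perp_def wxy add.commute)
  moreover have "star y * x = 0" "y * star x = 0"
    using summands_product(2) summands_star_closed x y by blast+
  ultimately have "y = 0" by (rule bj_orthogonal_to_extension[rotated 2])
  then show "w \<in> pseudo_abelian_summand F smul" using wxy x by simp
qed

end

theorem theorem1p2:
  fixes F :: "complex set"
    and smul :: "complex \<Rightarrow> 'a::real_normed_algebra \<Rightarrow> 'a"
    and star :: "'a \<Rightarrow> 'a"
  assumes "finite_dimensional_cstar_algebra F smul star"
  shows "set_perp F smul (left_symmetric_elements F smul) = nonpseudo_abelian_summand F smul \<and>
    set_perp F smul (set_perp F smul (left_symmetric_elements F smul)) =
      pseudo_abelian_summand F smul"
proof -
  interpret finite_dimensional_cstar_algebra F smul star by (rule assms)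
  show ?thesis using set_perp_left_symmetric set_perp_nonpseudo_abelian by simp
qed

end
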